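(* For every language $L$ (possibly involving both relations and functions) containing a binary relation symbol $\leq$, the class $\overrightarrow{\mathrm{Str}}(L)$ of all finite $L$-structures $\mathbf A$ in which $\leq_{\mathbf A}$ is a linear order of the vertex set $A$ is a Ramsey class.
   Context: A language $L$ consists of relation symbols and function symbols, each with an arity (a positive integer). An $L$-structure $\mathbf A$ has a vertex set $A$, a relation $R_{\mathbf A}\subseteq A^r$ for each relation symbol $R$ of arity $r$, and a partial function $F_{\mathbf A}:\mathrm{Dom}(F_{\mathbf A})\to A$ with $\mathrm{Dom}(F_{\mathbf A})\subseteq A^r$ for each function symbol $F$ of arity $r$. An embedding $f:\mathbf A\to\mathbf B$ is an injective map $f:A\to B$ such that for all tuples $\bar x$ (applying $f$ coordinatewise): $\bar x\in R_{\mathbf A}\iff f(\bar x)\in R_{\mathbf B}$; $\bar x\in\mathrm{Dom}(F_{\mathbf A})\iff f(\bar x)\in\mathrm{Dom}(F_{\mathbf B})$; and $f(F_{\mathbf A}(\bar x))=F_{\mathbf B}(f(\bar x))$ for $\bar x\in\mathrm{Dom}(F_{\mathbf A})$. $\mathbf A$ is a substructure of $\mathbf B$ if $A\subseteq B$ and the inclusion is an embedding. $\binom{\mathbf B}{\mathbf A}$ is the set of substructures of $\mathbf B$ isomorphic to $\mathbf A$. $\mathbf C\longrightarrow(\mathbf B)^{\mathbf A}_k$ means: for every partition of $\binom{\mathbf C}{\mathbf A}$ into $k$ classes there is $\widetilde{\mathbf B}\in\binom{\mathbf C}{\mathbf B}$ such that $\binom{\widetilde{\mathbf B}}{\mathbf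 A}$ is contained in one class. A class $\mathcal C$ of finite structures is a Ramsey class if for all $\mathbf A,\mathbf B\in\mathcal C$ and all $k\ge1$ there is $\mathbf C\in\mathcal C$ with $\mathbf C\longrightarrow(\mathbf B)^{\mathbf A}_k$. *)

theory Defs
  imports Main
begin

record ('r, 'f) language =
  rel_symbols :: "'r set"
  fun_symbols :: "'f set"
  rel_arity :: "'r \<Rightarrow> nat"
  fun_arity :: "'f \<Rightarrow> nat"

definition is_language :: "('r, 'f) language \<Rightarrow> bool" where
  "is_language L \<longleftrightarrow>
     (\<forall>R\<in>rel_symbols L. 0 < rel_arity L R) \<and> (\<forall>F\<in>fun_symbols L. 0 < fun_arity L F)"

definition tuples :: "'v set \<Rightarrow> nat \<Rightarrow> 'v list set" where
  "tuples V r = {xs. length xs = r \<and> set xs \<subseteq> V}"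

record ('v, 'r, 'f) lstruct =
  Verts :: "'v set"
  Rel :: "'r \<Rightarrow> 'v list set"
  Fn :: "'f \<Rightarrow> 'v list \<rightharpoonup> 'v"

text \<open>
  The domain of the partial function interpreting \<open>F\<close> is \<open>dom (Fn A F)\<close>.
  The types of symbols may contain symbols outside the language; these are interpreted
  by default values, so that equality of records is equality of structures (and the sets
  of copies below contain each substructure exactly once).
\<close>

definition is_structure :: "('r, 'f) language \<Rightarrow> ('v, 'r, 'f) lstruct \<Rightarrow> bool" where
  "is_structure L A \<longleftrightarrow>
     (\<forall>R\<in>rel_symbols L. Rel A R \<subseteq> tuples (Verts A) (rel_arity L R)) \<and>
     (\<forall>F\<in>fun_symbols L. dom (Fn A F) \<subseteq> tuples (Verts A) (fun_arity L F) \<and>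
                          ran (Fn A F) \<subseteq> Verts A) \<and>
     (\<forall>R. R \<notin> rel_symbols L \<longrightarrow> Rel A R = {}) \<and>
     (\<forall>F. F \<notin> fun_symbols L \<longrightarrow> Fn A F = Map.empty)"

definition embedding ::
  "('r, 'f) language \<Rightarrow> ('v \<Rightarrow> 'w) \<Rightarrow> ('v, 'r, 'f) lstruct \<Rightarrow> ('w, 'r, 'f) lstruct \<Rightarrow> bool" where
  "embedding L f A B \<longleftrightarrow>
     inj_on f (Verts A) \<and> f ` Verts A \<subseteq> Verts B \<and>
     (\<forall>R\<in>rel_symbols L. \<forall>xs\<in>tuples (Verts A) (rel_arity L R).
        xs \<in> Rel A R \<longleftrightarrow> map f xs \<in> Rel B R) \<and>
     (\<forall>F\<in>fun_symbols L. \<forall>xs\<in>tuples (Verts A) (fun_arity L F).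
        xs \<in> dom (Fn A F) \<longleftrightarrow> map f xs \<in> dom (Fn B F)) \<and>
     (\<forall>F\<in>fun_symbols L. \<forall>xs\<in>dom (Fn A F).
        f (the (Fn A F xs)) = the (Fn B F (map f xs)))"

definition isomorphic ::
  "('r, 'f) language \<Rightarrow> ('v, 'r, 'f) lstruct \<Rightarrow> ('w, 'r, 'f) lstruct \<Rightarrow> bool" where
  "isomorphic L A B \<longleftrightarrow> (\<exists>f. embedding L f A B \<and> f ` Verts A = Verts B)"

definition substructure ::
  "('r, 'f) language \<Rightarrow> ('v, 'r, 'f) lstruct \<Rightarrow> ('v, 'r, 'f) lstruct \<Rightarrow> bool" where
  "substructure L A B \<longleftrightarrow>
     is_structure L A \<and> is_structure L B \<and> Verts A \<subseteq> Verts B \<and> embedding L id A B"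

definition copies ::
  "('r, 'f) language \<Rightarrow> ('v, 'r, 'f) lstruct \<Rightarrow> ('v, 'r, 'f) lstruct \<Rightarrow> ('v, 'r, 'f) lstruct set" where
  "copies L B A = {A'. substructure L A' B \<and> isomorphic L A A'}"

text \<open>
  The arrow \<open>C \<longrightarrow> (B)\<^sup>A\<^sub>k\<close>. The partition is an indexed family of \<open>k\<close> pairwise disjoint
  classes, some of which may be empty, as usual for colourings.
\<close>

definition ramsey_arrow ::
  "('r, 'f) language \<Rightarrow> ('v, 'r, 'f) lstruct \<Rightarrow> ('v, 'r, 'f) lstruct \<Rightarrow> ('v, 'r, 'f) lstruct \<Rightarrow> nat \<Rightarrow> bool"
  where
  "ramsey_arrow L C B A k \<longleftrightarrow>
     (\<forall>P :: nat \<Rightarrow> ('v, 'r, 'f) lstruct set.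
        (\<Union>i<k. P i) = copies L C A \<and> (\<forall>i<k. \<forall>j<k. i \<noteq> j \<longrightarrow> P i \<inter> P j = {}) \<longrightarrow>
        (\<exists>B'\<in>copies L C B. \<exists>i<k. copies L B' A \<subseteq> P i))"

definition ramsey_class :: "('r, 'f) language \<Rightarrow> ('v, 'r, 'f) lstruct set \<Rightarrow> bool" where
  "ramsey_class L K \<longleftrightarrow>
     (\<forall>A\<in>K. is_structure L A \<and> finite (Verts A)) \<and>
     (\<forall>A\<in>K. \<forall>B\<in>K. \<forall>k\<ge>1. \<exists>C\<in>K. ramsey_arrow L C B A k)"

text \<open>
  Vertices are drawn from the type \<open>'v\<close>; every finite ordered structure is represented up to
  isomorphism only when \<open>'v\<close> is infinite.
\<close>

definition ordered_structures ::
  "('r, 'f) language \<Rightarrow> 'r \<Rightarrow> ('v, 'r, 'f) lstruct set" where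
  "ordered_structures L le =
     {A. is_structure L A \<and> finite (Verts A) \<and>
         linear_order_on (Verts A) {(x, y). [x, y] \<in> Rel A le}}"

end

theory Submission
  imports Defs "HOL-Library.Ramsey"
begin

text \<open>
  The proof is a variant of the partite construction of Nesetril and Rodl. Suppose that the vertices
  of a finite structure \<open>P\<close> carry labels, and consider the copies of \<open>A\<close> in \<open>P\<close> whose vertices have prescribed
  distinct labels, the sections over an injection \<open>s\<close> of the vertices of \<open>A\<close> into the labels. The heart of the
  matter is \<open>partite_lemma\<close>: there is a labelled structure \<open>P'\<close> such that every colouring of the copies of
  \<open>A\<close> in \<open>P'\<close> is constant on the sections over \<open>s\<close> of some copy of \<open>P\<close>. Iteration over all \<open>s\<close> makes the colour of a
  section depend only on its labels. If the construction starts with a disjoint union of copies of \<open>B\<close> whose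
  labels run over all subsets, of the size of \<open>B\<close>, of a large initial segment of the natural numbers,
  Ramsey's theorem for finite sets finishes the proof (\<open>ordered_structures_arrow\<close>).

  The partite lemma rests on the theorem of Hales and Jewett for words over the alphabet of sections.
  Every line of words gives a copy of \<open>P\<close> in a power of \<open>P\<close>: vertices with labels in the image of \<open>s\<close> move along the
  moving coordinates and follow the sections along the fixed ones, and the remaining vertices are
  separate for each line. The union of these copies is consistent as far as relations and domains of
  functions are concerned. It need not be consistent for the values of functions: two lines with the
  same moving coordinates may agree at a tuple but not at its value, if the label of this value is
  not the one dictated by \<open>A\<close>. If the functions over the image of \<open>s\<close> do project to those of \<open>A\<close>, there is no
  conflict, and \<open>partite_lemma_over_closed_base\<close> follows at once.

  In general the union of the copies is a structure \<open>D\<close> with multi-valued functions. The copies of \<open>P\<close> need not be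
  closed in \<open>D\<close>, but the copies of \<open>A\<close> that correspond to words are: every tuple in them that some line hits lies
  in a section, and the value of a function at a tuple of a section is determined by \<open>A\<close>. Now \<open>D\<close> serves as the
  set of labels for a second construction, which starts with the disjoint union of all the copies of
  \<open>P\<close> and applies the closed case to each word in turn. This makes the colour of a copy of \<open>A\<close> depend only on its
  word in \<open>D\<close>, where a monochromatic line is available.
\<close>

section \<open>The Hales--Jewett theorem\<close>

definition fill :: "'a option list \<Rightarrow> 'a \<Rightarrow> 'a list" where
  "fill \<tau> a = map (case_option a id) \<tau>"

text \<open>
  A combinatorial line is a word in which \<open>None\<close> marks the moving positions.
\<close>

definition lines :: "'a set \<Rightarrow> nat \<Rightarrow> 'a option list set" where
  "lines S n = {\<tau>. length \<tau> = n \<and> set \<tau> \<subseteq> insert None (Some ` S) \<and> None \<in> set \<tau>}"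

definition fill_blocks :: "'a option list list \<Rightarrow> 'a list \<Rightarrow> 'a list" where
  "fill_blocks Ls z = concat (map2 fill Ls z)"

lemma finite_tuples: "finite S \<Longrightarrow> finite (tuples S n)"
  unfolding tuples_def by (rule finite_subset[OF _ finite_lists_length_eq[of S n]]) auto

lemma finite_lines:
  assumes "finite S" shows "finite (lines S n)"
proof (rule finite_subset)
  show "lines S n \<subseteq> tuples (insert None (Some ` S)) n"
    by (auto simp: lines_def tuples_def)
qed (use assms in \<open>simp add: finite_tuples\<close>)

lemma fill_in_tuples: "\<tau> \<in> lines S n \<Longrightarrow> a \<in> S \<Longrightarrow> fill \<tau> a \<in> tuples S n"
  by (auto simp: lines_def tuples_def fill_def split: option.split)

lemma fill_blocks_Cons [simp]: "fill_blocks (L # Ls) (a # z) = fill L a @ fill_blocks Ls z"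
  by (simp add: fill_blocks_def)

lemma fill_blocks_Nil [simp]: "fill_blocks [] z = []"
  by (simp add: fill_blocks_def)

definition cuboid :: "'a set \<Rightarrow> nat \<Rightarrow> 'a option list list \<Rightarrow> bool" where
  "cuboid S N Ls \<longleftrightarrow> (\<forall>L\<in>set Ls. L \<in> lines S (length L)) \<and> sum_list (map length Ls) = N"

lemma fill_blocks_in_tuples:
  "cuboid S N Ls \<Longrightarrow> z \<in> tuples S (length Ls) \<Longrightarrow> fill_blocks Ls z \<in> tuples S N"
proof (induction Ls arbitrary: N z)
  case Nil
  then show ?case by (simp add: cuboid_def tuples_def)
next
  case (Cons L Ls)
  then obtain a z' where z: "z = a # z'" "a \<in> S" "z' \<in> tuples S (length Ls)"
    by (cases z) (auto simp: tuples_def)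
  have "fill_blocks Ls z' \<in> tuples S (N - length L)"
    by (rule Cons.IH) (use Cons.prems z in \<open>auto simp: cuboid_def\<close>)
  moreover have "fill L a \<in> tuples S (length L)"
    by (rule fill_in_tuples) (use Cons.prems z in \<open>auto simp: cuboid_def\<close>)
  moreover have "length L \<le> N" using Cons.prems by (auto simp: cuboid_def)
  ultimately show ?case using z by (auto simp: tuples_def)
qed

text \<open>
  This is Shelah's step in the proof of the Hales--Jewett theorem. In a block of length \<open>m\<close> consider the
  \<open>m + 1\<close> words \<open>x \<dots> x y \<dots> y\<close>. If \<open>m\<close> exceeds the number of ways in which such a word can colour all its
  continuations, two of these words are indistinguishable, and the positions in which they differ are
  the moving part of a line on which \<open>x\<close> and \<open>y\<close> may be exchanged. The other blocks come from the
  induction hypothesis, applied to the colouring of the remaining word by the function that sends the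
  letter in the first block to the colour of the whole word.
\<close>

lemma flip_invariant_cuboid:
  fixes S :: "'a set"
  assumes "finite S" "x \<in> S" "y \<in> S"
  shows "\<exists>N. \<forall>\<chi>::'a list \<Rightarrow> nat. \<chi> ` tuples S N \<subseteq> {..<k} \<longrightarrow>
    (\<exists>Ls. length Ls = n \<and> cuboid S N Ls \<and>
      (\<forall>z\<in>tuples S n. \<forall>z'\<in>tuples S n. list_all2 (\<lambda>c c'. c = c' \<or> {c, c'} = {x, y}) z z' \<longrightarrow>
         \<chi> (fill_blocks Ls z) = \<chi> (fill_blocks Ls z')))"
proof (induction n arbitrary: k)
  case 0
  show ?case
    by (rule exI[of _ 0]) (auto simp: cuboid_def)
next
  case (Suc n)
  define C where "C = (S \<rightarrow>\<^sub>E {..<k})"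
  have "finite C" using assms by (auto simp: C_def intro: finite_PiE)
  then obtain enc where enc: "bij_betw enc C {..<card C}"
    using ex_bij_betw_finite_nat atLeast0LessThan by metis
  obtain N where N: "\<And>\<chi>::'a list \<Rightarrow> nat. \<chi> ` tuples S N \<subseteq> {..<card C} \<Longrightarrow>
    (\<exists>Ls. length Ls = n \<and> cuboid S N Ls \<and>
      (\<forall>z\<in>tuples S n. \<forall>z'\<in>tuples S n. list_all2 (\<lambda>c c'. c = c' \<or> {c, c'} = {x, y}) z z' \<longrightarrow>
         \<chi> (fill_blocks Ls z) = \<chi> (fill_blocks Ls z')))"
    using Suc.IH[of "card C"] by meson
  define D where "D = (tuples S N \<rightarrow>\<^sub>E {..<k})"
  have finD: "finite D" using assms by (auto simp: D_def intro: finite_PiE finite_tuples)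
  define m where "m = card D"
  show ?case
  proof (rule exI[of _ "m + N"], intro allI impI)
    fix \<chi> :: "'a list \<Rightarrow> nat"
    assume \<chi>: "\<chi> ` tuples S (m + N) \<subseteq> {..<k}"
    define step where "step = (\<lambda>p. replicate p x @ replicate (m - p) y)"
    have step: "step p \<in> tuples S m" if "p \<le> m" for p
      using that assms by (auto simp: step_def tuples_def)
    have app: "u @ v \<in> tuples S (m + N)" if "u \<in> tuples S m" "v \<in> tuples S N" for u v
      using that by (auto simp: tuples_def)
    have "(\<lambda>p. restrict (\<lambda>z. \<chi> (step p @ z)) (tuples S N)) ` {..m} \<subseteq> D"
      using \<chi> app step by (auto simp: D_def image_subset_iff)
    moreover have "card D < card {..m}" by (simp add: m_def)
    ultimately have "\<not> inj_on (\<lambda>p. restrict (\<lambda>z. \<chi> (step p @ z)) (tuples S N)) {..m}"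
      using finD card_inj_on_le by (metis leD)
    then obtain p q where pq: "p < q" "q \<le> m"
      and eq: "restrict (\<lambda>z. \<chi> (step p @ z)) (tuples S N) = restrict (\<lambda>z. \<chi> (step q @ z)) (tuples S N)"
      unfolding inj_on_def by (metis atMost_iff linorder_neqE_nat)
    define L where "L = replicate p (Some x) @ replicate (q - p) None @ replicate (m - q) (Some y)"
    have L: "L \<in> lines S m" "length L = m"
      using pq assms by (auto simp: L_def lines_def)
    have Lx: "fill L x = step q"
      using pq by (simp add: L_def fill_def step_def flip: replicate_add)
    have Ly: "fill L y = step p"
      using pq by (simp add: L_def fill_def step_def map_replicate_const replicate_add [symmetric]
          del: replicate_add)
    have flip: "\<chi> (fill L c @ z) = \<chi> (fill L c' @ z)"
      if "z \<in> tuples S N" "c = c' \<or> {c, c'} = {x, y}" for z c c'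
      using fun_cong[OF eq, of z] that Lx Ly by (auto simp: doubleton_eq_iff)
    define \<psi> where "\<psi> = (\<lambda>z. enc (restrict (\<lambda>c. \<chi> (fill L c @ z)) S))"
    have inC: "restrict (\<lambda>c. \<chi> (fill L c @ z)) S \<in> C" if "z \<in> tuples S N" for z
      using \<chi> that app fill_in_tuples[OF L(1)] by (auto simp: C_def image_subset_iff)
    have "\<psi> ` tuples S N \<subseteq> {..<card C}"
      using inC enc by (auto simp: \<psi>_def bij_betw_def)
    from N[OF this] obtain Ls where Ls: "length Ls = n" "cuboid S N Ls"
      and inv: "\<And>z z'. z\<in>tuples S n \<Longrightarrow> z'\<in>tuples S n \<Longrightarrow>
        list_all2 (\<lambda>c c'. c = c' \<or> {c, c'} = {x, y}) z z' \<Longrightarrow>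
         \<psi> (fill_blocks Ls z) = \<psi> (fill_blocks Ls z')"
      by blast
    have step_inv: "\<chi> (fill L c @ fill_blocks Ls z) = \<chi> (fill L c @ fill_blocks Ls z')"
      if "z\<in>tuples S n" "z'\<in>tuples S n" "c \<in> S"
        "list_all2 (\<lambda>c c'. c = c' \<or> {c, c'} = {x, y}) z z'" for z z' c
    proof -
      have "restrict (\<lambda>c. \<chi> (fill L c @ fill_blocks Ls z)) S
          = restrict (\<lambda>c. \<chi> (fill L c @ fill_blocks Ls z')) S"
        using inv[OF that(1,2,4)] inC fill_blocks_in_tuples[OF Ls(2)] that(1,2) enc Ls(1)
        unfolding \<psi>_def bij_betw_def inj_on_def by metis
      from fun_cong[OF this, of c] show ?thesis using that(3) by simp
    qed
    show "\<exists>Ls. length Ls = Suc n \<and> cuboid S (m + N) Ls \<and>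
      (\<forall>z\<in>tuples S (Suc n). \<forall>z'\<in>tuples S (Suc n).
         list_all2 (\<lambda>c c'. c = c' \<or> {c, c'} = {x, y}) z z' \<longrightarrow>
         \<chi> (fill_blocks Ls z) = \<chi> (fill_blocks Ls z'))"
    proof (intro exI[of _ "L # Ls"] conjI ballI impI)
      show "length (L # Ls) = Suc n" "cuboid S (m + N) (L # Ls)"
        using Ls L by (auto simp: cuboid_def)
      fix z z'
      assume z: "z \<in> tuples S (Suc n)" "z' \<in> tuples S (Suc n)"
        and rel: "list_all2 (\<lambda>c c'. c = c' \<or> {c, c'} = {x, y}) z z'"
      obtain c zs where zs: "z = c # zs" "c \<in> S" "zs \<in> tuples S n"
        using z(1) by (cases z) (auto simp: tuples_def)
      obtain c' zs' where zs': "z' = c' # zs'" "c' \<in> S" "zs' \<in> tuples S n"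
        using z(2) by (cases z') (auto simp: tuples_def)
      have "\<chi> (fill L c @ fill_blocks Ls zs) = \<chi> (fill L c @ fill_blocks Ls zs')"
        using step_inv zs zs' rel by auto
      also have "\<dots> = \<chi> (fill L c' @ fill_blocks Ls zs')"
        by (rule flip) (use rel zs zs' fill_blocks_in_tuples[OF Ls(2)] Ls(1) in auto)
      finally show "\<chi> (fill_blocks (L # Ls) z) = \<chi> (fill_blocks (L # Ls) z')"
        using zs zs' by simp
    qed
  qed
qed

text \<open>
  A line in the cube of blocks, spelled out as a line in the cube of letters.
\<close>

definition fill_template :: "'a option list list \<Rightarrow> 'a option list \<Rightarrow> 'a option list" where
  "fill_template Ls \<tau> = concat (map2 (\<lambda>L. case_option L (\<lambda>a. map Some (fill L a))) Ls \<tau>)"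

lemma fill_fill_template:
  "length Ls = length \<tau> \<Longrightarrow> fill (fill_template Ls \<tau>) a = fill_blocks Ls (fill \<tau> a)"
proof (induction Ls \<tau> rule: list_induct2)
  case Nil
  then show ?case by (simp add: fill_template_def fill_def)
next
  case (Cons L Ls t \<tau>)
  have "fill (case_option L (\<lambda>a. map Some (fill L a)) t) a = fill L (case_option a id t)"
    by (cases t) (auto simp: fill_def comp_def)
  moreover have "fill (u @ v) a = fill u a @ fill v a" for u v
    by (simp add: fill_def)
  moreover have "fill_template (L # Ls) (t # \<tau>)
      = case_option L (\<lambda>a. map Some (fill L a)) t @ fill_template Ls \<tau>"
    by (simp add: fill_template_def)
  moreover have "fill (t # \<tau>) a = case_option a id t # fill \<tau> a"
    by (simp add: fill_def)
  ultimately show ?case using Cons.IH by (simp only: fill_blocks_Cons)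
qed

lemma fill_template_in_lines:
  assumes "cuboid S N Ls" "\<tau> \<in> lines S (length Ls)"
  shows "fill_template Ls \<tau> \<in> lines S N"
proof -
  have "length Ls = length \<tau>" using assms by (auto simp: lines_def)
  then have "length (fill_template Ls \<tau>) = sum_list (map length Ls)
      \<and> (None \<in> set \<tau> \<longrightarrow> None \<in> set (fill_template Ls \<tau>))
      \<and> set (fill_template Ls \<tau>) \<subseteq> insert None (Some ` S)"
    if "\<forall>L\<in>set Ls. L \<in> lines S (length L)" "set \<tau> \<subseteq> insert None (Some ` S)"
    using that
  proof (induction Ls \<tau> rule: list_induct2)
    case Nil
    then show ?case by (simp add: fill_template_def)
  next
    case (Cons L Ls t \<tau>)
    have L: "L \<in> lines S (length L)" using Cons.prems by simp
    show ?case
    proof (cases t)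
      case None
      then show ?thesis using Cons L by (auto simp: fill_template_def lines_def)
    next
      case (Some a)
      then have "a \<in> S" using Cons.prems by auto
      from fill_in_tuples[OF L this] Some Cons show ?thesis
        by (auto simp: fill_template_def tuples_def)
    qed
  qed
  then show ?thesis using assms by (auto simp: cuboid_def lines_def)
qed

text \<open>
  Induction on the alphabet: if exchanging \<open>x\<close> and \<open>y\<close> does not change the colour, a line that is
  monochromatic for the letters other than \<open>y\<close> is monochromatic for \<open>y\<close> as well.
\<close>

theorem Hales_Jewett:
  fixes S :: "'a set"
  assumes "finite S"
  shows "\<exists>N. \<forall>\<chi>::'a list \<Rightarrow> nat. \<chi> ` tuples S N \<subseteq> {..<k} \<longrightarrow>
    (\<exists>\<tau>\<in>lines S N. \<exists>c. \<forall>a\<in>S. \<chi> (fill \<tau> a) = c)"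
  using assms
proof (induction S rule: finite_induct)
  case empty
  have "[None] \<in> lines {} 1" by (simp add: lines_def)
  then show ?case by blast
next
  case (insert y S)
  show ?case
  proof (cases "S = {}")
    case True
    have "[None] \<in> lines (insert y S) 1" by (simp add: lines_def)
    with True show ?thesis by blast
  next
    case False
    then obtain x where x: "x \<in> S" by blast
    let ?S = "insert y S"
    obtain n where n: "\<And>\<chi>::'a list \<Rightarrow> nat. \<chi> ` tuples S n \<subseteq> {..<k} \<Longrightarrow>
        (\<exists>\<tau>\<in>lines S n. \<exists>c. \<forall>a\<in>S. \<chi> (fill \<tau> a) = c)"
      using insert.IH by blast
    obtain N where N: "\<And>\<chi>::'a list \<Rightarrow> nat. \<chi> ` tuples ?S N \<subseteq> {..<k} \<Longrightarrow>
      (\<exists>Ls. length Ls = n \<and> cuboid ?S N Ls \<and>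
        (\<forall>z\<in>tuples ?S n. \<forall>z'\<in>tuples ?S n. list_all2 (\<lambda>c c'. c = c' \<or> {c, c'} = {x, y}) z z' \<longrightarrow>
         \<chi> (fill_blocks Ls z) = \<chi> (fill_blocks Ls z')))"
      using flip_invariant_cuboid[of ?S x y k n] insert.hyps x by auto
    show ?thesis
    proof (intro exI[of _ N] allI impI)
      fix \<chi> :: "'a list \<Rightarrow> nat"
      assume \<chi>: "\<chi> ` tuples ?S N \<subseteq> {..<k}"
      from N[OF this] obtain Ls where Ls: "length Ls = n" "cuboid ?S N Ls"
        and inv: "\<And>z z'. z\<in>tuples ?S n \<Longrightarrow> z'\<in>tuples ?S n \<Longrightarrow>
          list_all2 (\<lambda>c c'. c = c' \<or> {c, c'} = {x, y}) z z' \<Longrightarrow>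
           \<chi> (fill_blocks Ls z) = \<chi> (fill_blocks Ls z')"
        by blast
      have "tuples S n \<subseteq> tuples ?S n" by (auto simp: tuples_def)
      then have "(\<lambda>z. \<chi> (fill_blocks Ls z)) ` tuples S n \<subseteq> {..<k}"
        using \<chi> fill_blocks_in_tuples[OF Ls(2)] Ls(1) by blast
      from n[OF this] obtain \<tau> c where \<tau>: "\<tau> \<in> lines S n"
        and c: "\<And>a. a \<in> S \<Longrightarrow> \<chi> (fill_blocks Ls (fill \<tau> a)) = c" by blast
      have \<tau>': "\<tau> \<in> lines ?S n" using \<tau> by (auto simp: lines_def)
      have "\<chi> (fill_blocks Ls (fill \<tau> y)) = \<chi> (fill_blocks Ls (fill \<tau> x))"
      proof (rule inv)
        show "fill \<tau> y \<in> tuples ?S n" "fill \<tau> x \<in> tuples ?S n"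
          using fill_in_tuples[OF \<tau>'] x by auto
        show "list_all2 (\<lambda>c c'. c = c' \<or> {c, c'} = {x, y}) (fill \<tau> y) (fill \<tau> x)"
          by (auto simp: fill_def list_all2_conv_all_nth split: option.split)
      qed
      then have "\<forall>a\<in>?S. \<chi> (fill_blocks Ls (fill \<tau> a)) = c" using c x by auto
      then have "\<forall>a\<in>?S. \<chi> (fill (fill_template Ls \<tau>) a) = c"
        using fill_fill_template[of Ls \<tau>] Ls(1) \<tau> by (auto simp: lines_def)
      moreover have "fill_template Ls \<tau> \<in> lines ?S N"
        using fill_template_in_lines[OF Ls(2)] \<tau>' Ls(1) by auto
      ultimately show "\<exists>\<tau>\<in>lines ?S N. \<exists>c. \<forall>a\<in>?S. \<chi> (fill \<tau> a) = c" by blast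
    qed
  qed
qed

section \<open>Embeddings and induced substructures\<close>

lemma embedding_in_Verts: "embedding L f A B \<Longrightarrow> x \<in> Verts A \<Longrightarrow> f x \<in> Verts B"
  by (auto simp: embedding_def)

lemma embedding_inj_on: "embedding L f A B \<Longrightarrow> inj_on f (Verts A)"
  by (simp add: embedding_def)

lemma embedding_Rel_iff:
  "embedding L f A B \<Longrightarrow> R \<in> rel_symbols L \<Longrightarrow> xs \<in> tuples (Verts A) (rel_arity L R) \<Longrightarrow>
    map f xs \<in> Rel B R \<longleftrightarrow> xs \<in> Rel A R"
  by (simp add: embedding_def)

lemma embedding_dom_iff:
  "embedding L f A B \<Longrightarrow> F \<in> fun_symbols L \<Longrightarrow> xs \<in> tuples (Verts A) (fun_arity L F) \<Longrightarrow>
    map f xs \<in> dom (Fn B F) \<longleftrightarrow> xs \<in> dom (Fn A F)"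
  unfolding embedding_def by blast

lemma embedding_Fn:
  "embedding L f A B \<Longrightarrow> F \<in> fun_symbols L \<Longrightarrow> xs \<in> dom (Fn A F) \<Longrightarrow>
    the (Fn B F (map f xs)) = f (the (Fn A F xs))"
  unfolding embedding_def by metis

lemma tuples_map: "f ` V \<subseteq> W \<Longrightarrow> xs \<in> tuples V n \<Longrightarrow> map f xs \<in> tuples W n"
  by (auto simp: tuples_def)

lemma structure_Rel_tuples:
  "is_structure L A \<Longrightarrow> R \<in> rel_symbols L \<Longrightarrow> xs \<in> Rel A R \<Longrightarrow> xs \<in> tuples (Verts A) (rel_arity L R)"
  by (auto simp: is_structure_def)

lemma structure_dom_tuples:
  "is_structure L A \<Longrightarrow> F \<in> fun_symbols L \<Longrightarrow> xs \<in> dom (Fn A F) \<Longrightarrow> xs \<in> tuples (Verts A) (fun_arity L F)"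
  unfolding is_structure_def by blast

lemma structure_Fn_in_Verts:
  "is_structure L A \<Longrightarrow> xs \<in> dom (Fn A F) \<Longrightarrow> the (Fn A F xs) \<in> Verts A"
  unfolding is_structure_def by (cases "F \<in> fun_symbols L") (force simp: ran_def)+

lemma structure_dom_fun_symbols:
  "is_structure L A \<Longrightarrow> xs \<in> dom (Fn A F) \<Longrightarrow> F \<in> fun_symbols L"
  unfolding is_structure_def by force

lemma structure_Rel_rel_symbols:
  "is_structure L A \<Longrightarrow> xs \<in> Rel A R \<Longrightarrow> R \<in> rel_symbols L"
  unfolding is_structure_def by force

lemma embedding_comp:
  assumes "embedding L f A B" "embedding L g B C" "is_structure L A"
  shows "embedding L (g \<circ> f) A C"
proof -
  have fV: "f ` Verts A \<subseteq> Verts B" using assms(1) by (simp add: embedding_def)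
  note maps = tuples_map[OF fV]
  have inj: "inj_on (g \<circ> f) (Verts A)"
    using assms fV by (auto simp: embedding_def intro: comp_inj_on inj_on_subset)
  have img: "(g \<circ> f) ` Verts A \<subseteq> Verts C"
    using assms by (auto simp: embedding_def)
  have rel: "xs \<in> Rel A R \<longleftrightarrow> map (g \<circ> f) xs \<in> Rel C R"
    if "R \<in> rel_symbols L" "xs \<in> tuples (Verts A) (rel_arity L R)" for R xs
    using embedding_Rel_iff[OF assms(1) that] embedding_Rel_iff[OF assms(2) that(1) maps[OF that(2)]]
    by simp
  have dm: "xs \<in> dom (Fn A F) \<longleftrightarrow> map (g \<circ> f) xs \<in> dom (Fn C F)"
    if "F \<in> fun_symbols L" "xs \<in> tuples (Verts A) (fun_arity L F)" for F xs
    using embedding_dom_iff[OF assms(1) that] embedding_dom_iff[OF assms(2) that(1) maps[OF that(2)]]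
    by simp
  have fn: "(g \<circ> f) (the (Fn A F xs)) = the (Fn C F (map (g \<circ> f) xs))"
    if "F \<in> fun_symbols L" "xs \<in> dom (Fn A F)" for F xs
  proof -
    have xs: "xs \<in> tuples (Verts A) (fun_arity L F)"
      using assms(3) that by (rule structure_dom_tuples)
    then have "map f xs \<in> dom (Fn B F)"
      using embedding_dom_iff[OF assms(1) that(1)] that(2) by blast
    then show ?thesis
      using embedding_Fn[OF assms(1) that] embedding_Fn[OF assms(2) that(1)]
      by (metis comp_apply list.map_comp)
  qed
  show ?thesis
    unfolding embedding_def by (intro conjI ballI inj img rel dm fn; assumption)
qed

lemma embedding_cong:
  assumes "embedding L f A B" "is_structure L A" "\<And>x. x \<in> Verts A \<Longrightarrow> f x = g x"
  shows "embedding L g A B"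
proof -
  have m: "map g xs = map f xs" if "xs \<in> tuples (Verts A) n" for xs n
    using that assms(3) by (auto simp: tuples_def)
  have "inj_on g (Verts A) = inj_on f (Verts A)"
    using assms(3) by (intro inj_on_cong) auto
  moreover have "g ` Verts A = f ` Verts A"
    using assms(3) by auto
  moreover have "g (the (Fn A F xs)) = the (Fn B F (map g xs))"
    if "F \<in> fun_symbols L" "xs \<in> dom (Fn A F)" for F xs
    using assms that m[OF structure_dom_tuples[OF assms(2) that]]
      embedding_Fn[OF assms(1) that] structure_Fn_in_Verts[OF assms(2) that(2)] by metis
  ultimately show ?thesis using assms(1) m unfolding embedding_def by metis
qed

lemma embedding_inverse:
  assumes B: "is_structure L B" and B': "is_structure L B'"
    and m: "embedding L m B B'" and onto: "m ` Verts B = Verts B'"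
  shows "embedding L (inv_into (Verts B) m) B' B"
proof -
  let ?n = "inv_into (Verts B) m"
  have inj: "inj_on m (Verts B)" using m by (rule embedding_inj_on)
  have nV: "?n v \<in> Verts B" "m (?n v) = v" if "v \<in> Verts B'" for v
    using that onto by (auto simp: inv_into_into f_inv_into_f)
  have tup: "map ?n xs \<in> tuples (Verts B) r" "map m (map ?n xs) = xs" if "xs \<in> tuples (Verts B') r" for xs r
    using that nV by (auto simp: tuples_def subset_iff intro!: map_idI)
  have rel: "xs \<in> Rel B' R \<longleftrightarrow> map ?n xs \<in> Rel B R"
    if "R \<in> rel_symbols L" "xs \<in> tuples (Verts B') (rel_arity L R)" for R xs
    using embedding_Rel_iff[OF m that(1) tup(1)[OF that(2)]] tup(2)[OF that(2)] by (simp del: map_map)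
  have dm: "xs \<in> dom (Fn B' F) \<longleftrightarrow> map ?n xs \<in> dom (Fn B F)"
    if "F \<in> fun_symbols L" "xs \<in> tuples (Verts B') (fun_arity L F)" for F xs
    using embedding_dom_iff[OF m that(1) tup(1)[OF that(2)]] tup(2)[OF that(2)] by (simp del: map_map)
  have fn: "?n (the (Fn B' F xs)) = the (Fn B F (map ?n xs))"
    if "F \<in> fun_symbols L" "xs \<in> dom (Fn B' F)" for F xs
  proof -
    have xs: "xs \<in> tuples (Verts B') (fun_arity L F)" by (rule structure_dom_tuples[OF B' that])
    then have d: "map ?n xs \<in> dom (Fn B F)" using dm that by blast
    have "the (Fn B' F xs) = m (the (Fn B F (map ?n xs)))"
      using embedding_Fn[OF m that(1) d] tup(2)[OF xs] by simp
    then show ?thesis using inv_into_f_f[OF inj structure_Fn_in_Verts[OF B d]] by simp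
  qed
  have "inj_on ?n (Verts B')" using onto by (simp add: inj_on_inv_into)
  moreover have "?n ` Verts B' \<subseteq> Verts B" using nV by blast
  ultimately show ?thesis using rel dm fn unfolding embedding_def by (intro conjI ballI; assumption?)
qed

definition induced :: "('v, 'r, 'f) lstruct \<Rightarrow> 'v set \<Rightarrow> ('v, 'r, 'f) lstruct" where
  "induced C V = \<lparr>Verts = V, Rel = (\<lambda>R. {xs \<in> Rel C R. set xs \<subseteq> V}),
     Fn = (\<lambda>F xs. if set xs \<subseteq> V then Fn C F xs else None)\<rparr>"

lemma induced_simps:
  "Verts (induced C V) = V" "xs \<in> Rel (induced C V) R \<longleftrightarrow> xs \<in> Rel C R \<and> set xs \<subseteq> V"
  "Fn (induced C V) F xs = (if set xs \<subseteq> V then Fn C F xs else None)"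
  "xs \<in> dom (Fn (induced C V) F) \<longleftrightarrow> xs \<in> dom (Fn C F) \<and> set xs \<subseteq> V"
  by (simp_all add: induced_def domIff)

text \<open>
  A substructure is determined by its vertices, so that a colouring of copies amounts to a colouring of
  vertex sets of copies.
\<close>

lemma substructure_eq_induced:
  assumes "substructure L S C"
  shows "S = induced C (Verts S)"
proof -
  have S: "is_structure L S" and C: "is_structure L C" and e: "embedding L id S C"
    using assms by (auto simp: substructure_def)
  have rel: "xs \<in> Rel S R \<longleftrightarrow> xs \<in> Rel C R \<and> set xs \<subseteq> Verts S" for xs R
  proof (cases "R \<in> rel_symbols L \<and> xs \<in> tuples (Verts S) (rel_arity L R)")
    case True
    then show ?thesis using embedding_Rel_iff[OF e, of R xs] by (auto simp: tuples_def)
  next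
    case False
    have "xs \<notin> Rel S R"
      using False structure_Rel_rel_symbols[OF S, of xs R] structure_Rel_tuples[OF S, of R xs] by blast
    moreover have "\<not> (xs \<in> Rel C R \<and> set xs \<subseteq> Verts S)"
      using False structure_Rel_rel_symbols[OF C, of xs R] structure_Rel_tuples[OF C, of R xs]
      by (auto simp: tuples_def)
    ultimately show ?thesis by blast
  qed
  have dm: "xs \<in> dom (Fn S F) \<longleftrightarrow> xs \<in> dom (Fn C F) \<and> set xs \<subseteq> Verts S" for xs F
  proof (cases "F \<in> fun_symbols L \<and> xs \<in> tuples (Verts S) (fun_arity L F)")
    case True
    then show ?thesis using embedding_dom_iff[OF e, of F xs] unfolding tuples_def by simp
  next
    case False
    have "xs \<notin> dom (Fn S F)"
      using False structure_dom_fun_symbols[OF S, of xs F] structure_dom_tuples[OF S, of F xs] by blast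
    moreover have "\<not> (xs \<in> dom (Fn C F) \<and> set xs \<subseteq> Verts S)"
      using False structure_dom_fun_symbols[OF C, of xs F] structure_dom_tuples[OF C, of F xs]
      unfolding tuples_def by blast
    ultimately show ?thesis by blast
  qed
  have fn: "Fn S F xs = (if set xs \<subseteq> Verts S then Fn C F xs else None)" for F xs
  proof (cases "xs \<in> dom (Fn S F)")
    case True
    then have "the (Fn S F xs) = the (Fn C F xs)"
      using embedding_Fn[OF e structure_dom_fun_symbols[OF S True] True] by simp
    moreover have "xs \<in> dom (Fn C F)" "set xs \<subseteq> Verts S" using True dm by blast+
    ultimately show ?thesis using True by (metis domIff option.expand)
  next
    case False
    then show ?thesis using dm[of xs F] by (metis domIff)
  qed
  have "Rel S = Rel (induced C (Verts S))" using rel by (auto simp: induced_def fun_eq_iff)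
  moreover have "Fn S = Fn (induced C (Verts S))" using fn by (auto simp: induced_def fun_eq_iff)
  moreover have "Verts S = Verts (induced C (Verts S))" by (simp add: induced_simps)
  ultimately show ?thesis by simp
qed

lemma induced_image:
  assumes A: "is_structure L A" and C: "is_structure L C" and f: "embedding L f A C"
  defines "S \<equiv> induced C (f ` Verts A)"
  shows "substructure L S C" "embedding L f A S" "S \<in> copies L C A"
proof -
  have fV: "f ` Verts A \<subseteq> Verts C" using f by (simp add: embedding_def)
  have lift: "\<exists>ys. ys \<in> tuples (Verts A) r \<and> map f ys = xs" if "xs \<in> tuples W r" "set xs \<subseteq> f ` Verts A"
    for xs W r
  proof -
    have "map f (map (inv_into (Verts A) f) xs) = xs"
      using that(2) by (auto simp: f_inv_into_f intro!: map_idI)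
    moreover have "map (inv_into (Verts A) f) xs \<in> tuples (Verts A) r"
      using that by (auto simp: tuples_def intro!: inv_into_into)
    ultimately show ?thesis by blast
  qed
  have ran: "v \<in> f ` Verts A" if "Fn S F xs = Some v" for F xs v
  proof -
    have d: "xs \<in> dom (Fn C F)" "set xs \<subseteq> f ` Verts A" and v: "v = the (Fn C F xs)"
      using that by (auto simp: S_def induced_simps split: if_splits)
    have F: "F \<in> fun_symbols L" using structure_dom_fun_symbols[OF C d(1)] .
    obtain ys where ys: "ys \<in> tuples (Verts A) (fun_arity L F)" "map f ys = xs"
      using lift[OF structure_dom_tuples[OF C F d(1)] d(2)] by blast
    then have yd: "ys \<in> dom (Fn A F)" using embedding_dom_iff[OF f F] d(1) by blast
    show ?thesis
      using embedding_Fn[OF f F yd] ys(2) v structure_Fn_in_Verts[OF A yd] by auto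
  qed
  have S: "is_structure L S"
    unfolding is_structure_def
  proof (intro conjI ballI allI impI)
    show "Rel S R \<subseteq> tuples (Verts S) (rel_arity L R)" if "R \<in> rel_symbols L" for R
      using structure_Rel_tuples[OF C that] by (auto simp: S_def induced_simps tuples_def)
    show "dom (Fn S F) \<subseteq> tuples (Verts S) (fun_arity L F)" if "F \<in> fun_symbols L" for F
    proof
      fix xs assume "xs \<in> dom (Fn S F)"
      then have "xs \<in> dom (Fn C F)" "set xs \<subseteq> Verts S" unfolding S_def induced_simps by auto
      then show "xs \<in> tuples (Verts S) (fun_arity L F)"
        using structure_dom_tuples[OF C that] unfolding tuples_def by blast
    qed
    show "ran (Fn S F) \<subseteq> Verts S" for F
      using ran by (auto simp: ran_def S_def induced_simps(1))
    show "Rel S R = {}" if "R \<notin> rel_symbols L" for R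
      using C that by (auto simp: S_def induced_simps is_structure_def)
    show "Fn S F = Map.empty" if "F \<notin> fun_symbols L" for F
      using C that by (auto simp: S_def induced_simps is_structure_def fun_eq_iff)
  qed
  have VS: "Verts S = f ` Verts A" by (simp add: S_def induced_simps)
  have "embedding L id S C"
    unfolding embedding_def
    using fV by (auto simp: VS S_def induced_simps tuples_def domIff split: if_splits)
  then show sub: "substructure L S C" using S C fV VS by (simp add: substructure_def)
  have "map f xs \<in> Rel S R \<longleftrightarrow> map f xs \<in> Rel C R" if "xs \<in> tuples (Verts A) r" for xs r R
    using that by (auto simp: S_def induced_simps tuples_def)
  moreover have Fn_eq: "Fn S F (map f xs) = Fn C F (map f xs)" if "xs \<in> tuples (Verts A) r" for xs r F
    using that by (auto simp: S_def induced_simps tuples_def)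
  moreover have "map f xs \<in> dom (Fn S F) \<longleftrightarrow> map f xs \<in> dom (Fn C F)"
    if "xs \<in> tuples (Verts A) r" for xs r F
    using Fn_eq[OF that] by (simp add: domIff)
  moreover have "the (Fn S F (map f xs)) = the (Fn C F (map f xs))"
    if "F \<in> fun_symbols L" "xs \<in> dom (Fn A F)" for xs F
    using Fn_eq[OF structure_dom_tuples[OF A that]] by simp
  ultimately show emb: "embedding L f A S"
    using f VS unfolding embedding_def by simp
  show "S \<in> copies L C A"
    using sub emb VS by (auto simp: copies_def isomorphic_def)
qed

lemma substructure_trans:
  "substructure L R S \<Longrightarrow> substructure L S T \<Longrightarrow> substructure L R T"
  unfolding substructure_def using embedding_comp[of L id R S id T] by auto

section \<open>Gluing copies of a structure\<close>

text \<open>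
  The union of the images of one structure under a family of maps. The choice in the value of a function
  is harmless for a family that is \<open>glueable\<close>: then the images agree wherever they overlap, and each of them
  is a substructure of the union.
\<close>

definition glue ::
  "'i set \<Rightarrow> ('i \<Rightarrow> 'v \<Rightarrow> 'w) \<Rightarrow> ('v, 'r, 'f) lstruct \<Rightarrow> ('w, 'r, 'f) lstruct" where
  "glue I e P = \<lparr>
     Verts = (\<Union>i\<in>I. e i ` Verts P),
     Rel = (\<lambda>R. \<Union>i\<in>I. map (e i) ` Rel P R),
     Fn = (\<lambda>F zs. if \<exists>i\<in>I. zs \<in> map (e i) ` dom (Fn P F)
             then Some (SOME v. \<exists>i\<in>I. \<exists>xs\<in>dom (Fn P F). zs = map (e i) xs \<and> v = e i (the (Fn P F xs)))
             else None)\<rparr>"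

definition glueable ::
  "'i set \<Rightarrow> ('i \<Rightarrow> 'v \<Rightarrow> 'w) \<Rightarrow> ('v, 'r, 'f) lstruct \<Rightarrow> bool" where
  "glueable I e P \<longleftrightarrow> (\<forall>i\<in>I. inj_on (e i) (Verts P)) \<and>
     (\<forall>i\<in>I. \<forall>j\<in>I. \<forall>xs ys. set xs \<subseteq> Verts P \<longrightarrow> set ys \<subseteq> Verts P \<longrightarrow> map (e i) xs = map (e j) ys \<longrightarrow>
        (\<forall>R. ys \<in> Rel P R \<longrightarrow> xs \<in> Rel P R) \<and>
        (\<forall>F. ys \<in> dom (Fn P F) \<longrightarrow>
           xs \<in> dom (Fn P F) \<and> e i (the (Fn P F xs)) = e j (the (Fn P F ys))))"

lemma structure_tuple_subsets:
  assumes "is_structure L P"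
  shows "xs \<in> Rel P R \<Longrightarrow> set xs \<subseteq> Verts P" "xs \<in> dom (Fn P F) \<Longrightarrow> set xs \<subseteq> Verts P"
  using structure_Rel_tuples[OF assms structure_Rel_rel_symbols[OF assms]]
    structure_dom_tuples[OF assms structure_dom_fun_symbols[OF assms]]
  by (fastforce simp: tuples_def)+

lemma glue_dom: "dom (Fn (glue I e P) F) = (\<Union>i\<in>I. map (e i) ` dom (Fn P F))"
proof (rule set_eqI)
  show "zs \<in> dom (Fn (glue I e P) F) \<longleftrightarrow> zs \<in> (\<Union>i\<in>I. map (e i) ` dom (Fn P F))" for zs
    unfolding domIff[of zs "Fn (glue I e P) F"] by (simp add: glue_def)
qed

lemma glue_Fn:
  assumes "is_structure L P" "glueable I e P" "i \<in> I" "xs \<in> dom (Fn P F)"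
  shows "the (Fn (glue I e P) F (map (e i) xs)) = e i (the (Fn P F xs))"
proof -
  let ?Q = "\<lambda>v. \<exists>j\<in>I. \<exists>ys\<in>dom (Fn P F). map (e i) xs = map (e j) ys \<and> v = e j (the (Fn P F ys))"
  have "?Q (e i (the (Fn P F xs)))" using assms(3,4) by blast
  then have "?Q (SOME v. ?Q v)" by (rule someI)
  then obtain j ys where "j \<in> I" "ys \<in> dom (Fn P F)" "map (e i) xs = map (e j) ys"
    "(SOME v. ?Q v) = e j (the (Fn P F ys))" by blast
  moreover from this have "e i (the (Fn P F xs)) = e j (the (Fn P F ys))"
    using assms structure_tuple_subsets(2)[OF assms(1)] unfolding glueable_def by meson
  ultimately have "(SOME v. ?Q v) = e i (the (Fn P F xs))" by simp
  moreover have "\<exists>j\<in>I. map (e i) xs \<in> map (e j) ` dom (Fn P F)" using assms(3,4) by blast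
  ultimately show ?thesis by (simp add: glue_def)
qed

lemma glue_structure:
  assumes P: "is_structure L P" and g: "glueable I e P"
  shows "is_structure L (glue I e P)"
proof -
  have R: "Rel (glue I e P) R = (\<Union>i\<in>I. map (e i) ` Rel P R)" for R by (simp add: glue_def)
  have V: "Verts (glue I e P) = (\<Union>i\<in>I. e i ` Verts P)" by (simp add: glue_def)
  have "Rel (glue I e P) R \<subseteq> tuples (Verts (glue I e P)) (rel_arity L R)" if "R \<in> rel_symbols L" for R
    using structure_Rel_tuples[OF P that] unfolding R V by (fastforce simp: tuples_def)
  moreover have "dom (Fn (glue I e P) F) \<subseteq> tuples (Verts (glue I e P)) (fun_arity L F)"
    if "F \<in> fun_symbols L" for F
    using structure_dom_tuples[OF P that] unfolding glue_dom V tuples_def by fastforce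
  moreover have "ran (Fn (glue I e P) F) \<subseteq> Verts (glue I e P)" for F
  proof
    fix v assume "v \<in> ran (Fn (glue I e P) F)"
    then obtain zs where zs: "Fn (glue I e P) F zs = Some v" by (auto simp: ran_def)
    then have "zs \<in> dom (Fn (glue I e P) F)" by blast
    then obtain i xs where i: "i \<in> I" "xs \<in> dom (Fn P F)" "zs = map (e i) xs"
      unfolding glue_dom by blast
    then have "v = e i (the (Fn P F xs))"
      using glue_Fn[OF P g i(1,2)] zs by simp
    then show "v \<in> Verts (glue I e P)"
      using structure_Fn_in_Verts[OF P i(2)] i(1) unfolding V by blast
  qed
  moreover have "Rel (glue I e P) R = {}" if "R \<notin> rel_symbols L" for R
    using P that unfolding R by (auto simp: is_structure_def)
  moreover have "Fn (glue I e P) F = Map.empty" if "F \<notin> fun_symbols L" for F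
    using P that by (auto simp: is_structure_def glue_def)
  ultimately show ?thesis by (simp add: is_structure_def)
qed

lemma glue_embedding:
  assumes P: "is_structure L P" and g: "glueable I e P" and i: "i \<in> I"
  shows "embedding L (e i) P (glue I e P)"
proof -
  have "map (e i) xs \<in> Rel (glue I e P) R \<longleftrightarrow> xs \<in> Rel P R" if "set xs \<subseteq> Verts P" for R xs
  proof
    assume "map (e i) xs \<in> Rel (glue I e P) R"
    then obtain j ys where "j \<in> I" "ys \<in> Rel P R" "map (e i) xs = map (e j) ys"
      by (auto simp: glue_def)
    then show "xs \<in> Rel P R"
      using g i that structure_tuple_subsets(1)[OF P] unfolding glueable_def by meson
  qed (use i in \<open>auto simp: glue_def\<close>)
  moreover have "map (e i) xs \<in> dom (Fn (glue I e P) F) \<longleftrightarrow> xs \<in> dom (Fn P F)"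
    if "set xs \<subseteq> Verts P" for F xs
  proof
    assume "map (e i) xs \<in> dom (Fn (glue I e P) F)"
    then obtain j ys where "j \<in> I" "ys \<in> dom (Fn P F)" "map (e i) xs = map (e j) ys"
      unfolding glue_dom by blast
    then show "xs \<in> dom (Fn P F)"
      using g i that structure_tuple_subsets(2)[OF P] unfolding glueable_def by meson
  next
    assume "xs \<in> dom (Fn P F)"
    then show "map (e i) xs \<in> dom (Fn (glue I e P) F)" unfolding glue_dom using i by blast
  qed
  moreover have "inj_on (e i) (Verts P)" using g i by (simp add: glueable_def)
  moreover have "e i ` Verts P \<subseteq> Verts (glue I e P)" using i by (auto simp: glue_def)
  ultimately show ?thesis
    using glue_Fn[OF P g i] unfolding embedding_def tuples_def by auto
qed

text \<open>
  All intermediate structures live on natural numbers, so that constructions that change the type of the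
  vertices can be iterated. The map \<open>q\<close> recovers the original names of the vertices.
\<close>

lemma glue_into_naturals:
  fixes e :: "'i \<Rightarrow> 'v \<Rightarrow> 'w" and P :: "('v, 'r, 'f) lstruct"
  assumes P: "is_structure L P" "finite (Verts P)" and "finite I" and g: "glueable I e P"
  shows "\<exists>(U :: (nat, 'r, 'f) lstruct) (c :: 'w \<Rightarrow> nat) (q :: nat \<Rightarrow> 'w).
    is_structure L U \<and> finite (Verts U) \<and> (\<forall>i\<in>I. embedding L (c \<circ> e i) P U) \<and>
    (\<forall>i\<in>I. \<forall>v\<in>Verts P. q (c (e i v)) = e i v) \<and>
    (\<forall>F. \<forall>zs\<in>dom (Fn U F). \<exists>i\<in>I. \<exists>xs\<in>dom (Fn P F).
       zs = map (c \<circ> e i) xs \<and> the (Fn U F zs) = c (e i (the (Fn P F xs))))"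
proof -
  let ?V = "\<Union>i\<in>I. e i ` Verts P"
  have "finite ?V" using assms by blast
  then obtain c :: "'w \<Rightarrow> nat" where c: "inj_on c ?V"
    using finite_imp_inj_to_nat_seg by metis
  define h where "h = (\<lambda>i. c \<circ> e i)"
  define q where "q = inv_into ?V c"
  have q: "q (h i v) = e i v" if "i \<in> I" "v \<in> Verts P" for i v
    using that c by (auto simp: q_def h_def intro!: inv_into_f_f)
  have mq: "map q (map (h i) xs) = map (e i) xs" if "i \<in> I" "set xs \<subseteq> Verts P" for i xs
    using that q by auto
  have g': "glueable I h P"
    unfolding glueable_def
  proof (intro conjI ballI allI impI)
    fix i assume "i \<in> I"
    then show "inj_on (h i) (Verts P)"
      using g q unfolding glueable_def inj_on_def by metis
  next
    fix i j xs ys R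
    assume "i \<in> I" "j \<in> I" "set xs \<subseteq> Verts P" "set ys \<subseteq> Verts P" "map (h i) xs = map (h j) ys"
      "ys \<in> Rel P R"
    then show "xs \<in> Rel P R" using g mq unfolding glueable_def by metis
  next
    fix i j xs ys F
    assume a: "i \<in> I" "j \<in> I" "set xs \<subseteq> Verts P" "set ys \<subseteq> Verts P" "map (h i) xs = map (h j) ys"
      "ys \<in> dom (Fn P F)"
    then have "map (e i) xs = map (e j) ys" using mq by metis
    then have "xs \<in> dom (Fn P F) \<and> e i (the (Fn P F xs)) = e j (the (Fn P F ys))"
      using a g unfolding glueable_def by meson
    then show "xs \<in> dom (Fn P F)" "h i (the (Fn P F xs)) = h j (the (Fn P F ys))"
      by (auto simp: h_def)
  qed
  let ?U = "glue I h P"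
  have "finite (Verts ?U)" using assms by (simp add: glue_def)
  moreover have "\<exists>i\<in>I. \<exists>xs\<in>dom (Fn P F). zs = map (h i) xs \<and> the (Fn ?U F zs) = h i (the (Fn P F xs))"
    if zs: "zs \<in> dom (Fn ?U F)" for F zs
  proof -
    from zs obtain i xs where "i \<in> I" "xs \<in> dom (Fn P F)" "zs = map (h i) xs"
      unfolding glue_dom by blast
    then show ?thesis using glue_Fn[OF P(1) g'] by blast
  qed
  moreover have "q (c (e i v)) = e i v" if "i \<in> I" "v \<in> Verts P" for i v
    using q[OF that] by (simp add: h_def)
  ultimately show ?thesis
    using glue_structure[OF P(1) g'] glue_embedding[OF P(1) g'] unfolding h_def
    by (intro exI[of _ "glue I (\<lambda>i. c \<circ> e i) P"] exI[of _ c] exI[of _ q]) auto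
qed

text \<open>
  Symbols of arity zero would obstruct disjoint unions; positive arities ensure that a tuple determines
  the summand in which it lies.
\<close>

lemma glueable_disjoint:
  assumes "\<And>i. i \<in> I \<Longrightarrow> inj_on (e i) (Verts P)"
    and "\<And>i j v w. i \<in> I \<Longrightarrow> j \<in> I \<Longrightarrow> v \<in> Verts P \<Longrightarrow> w \<in> Verts P \<Longrightarrow> e i v = e j w \<Longrightarrow> i = j"
    and "is_structure L P" "is_language L"
  shows "glueable I e P"
proof -
  have *: "i = j \<and> xs = ys"
    if h: "i \<in> I" "j \<in> I" "set xs \<subseteq> Verts P" "set ys \<subseteq> Verts P" "map (e i) xs = map (e j) ys" "ys \<noteq> []"
    for i j xs ys
  proof -
    obtain x xs' y ys' where eq: "xs = x # xs'" "ys = y # ys'" using h(5,6) by (cases xs; cases ys) auto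
    then have "i = j" using assms(2)[of i j x y] h by auto
    moreover from this have "xs = ys"
      using h assms(1)[of j] inj_on_subset map_inj_on by (metis Un_least)
    ultimately show ?thesis by simp
  qed
  have ne_Rel: "ys \<noteq> []" if "ys \<in> Rel P R" for ys R
    using structure_Rel_tuples[OF assms(3) structure_Rel_rel_symbols[OF assms(3) that] that]
      structure_Rel_rel_symbols[OF assms(3) that] assms(4)
    by (auto simp: tuples_def is_language_def)
  have ne_dom: "ys \<noteq> []" if "ys \<in> dom (Fn P F)" for ys F
    using structure_dom_tuples[OF assms(3) structure_dom_fun_symbols[OF assms(3) that] that]
      structure_dom_fun_symbols[OF assms(3) that] assms(4)
    by (auto simp: tuples_def is_language_def)
  show ?thesis
    unfolding glueable_def
  proof (intro conjI ballI allI impI)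
    fix i j xs ys R
    assume "i \<in> I" "j \<in> I" "set xs \<subseteq> Verts P" "set ys \<subseteq> Verts P" "map (e i) xs = map (e j) ys"
      "ys \<in> Rel P R"
    then show "xs \<in> Rel P R" using *[of i j xs ys] ne_Rel[of ys R] by simp
  next
    fix i j xs ys F
    assume "i \<in> I" "j \<in> I" "set xs \<subseteq> Verts P" "set ys \<subseteq> Verts P" "map (e i) xs = map (e j) ys"
      "ys \<in> dom (Fn P F)"
    then have "i = j \<and> xs = ys" "ys \<in> dom (Fn P F)" using *[of i j xs ys] ne_dom[of ys F] by simp_all
    then show "xs \<in> dom (Fn P F)" "e i (the (Fn P F xs)) = e j (the (Fn P F ys))" by simp_all
  qed (use assms(1) in blast)
qed

section \<open>Labelled structures and sections\<close>

text \<open>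
  A map \<open>\<pi>\<close> that labels the vertices makes \<open>P\<close> a partite structure, and a section over \<open>s\<close> is a transversal
  copy of \<open>A\<close> whose vertices have the labels prescribed by \<open>s\<close>. Copies are represented by embeddings,
  which are extensional so that there are finitely many of them.
\<close>

definition sections ::
  "('r, 'f) language \<Rightarrow> ('a, 'r, 'f) lstruct \<Rightarrow> ('v, 'r, 'f) lstruct \<Rightarrow> ('v \<Rightarrow> 'y) \<Rightarrow> ('a \<Rightarrow> 'y) \<Rightarrow> ('a \<Rightarrow> 'v) set"
  where
  "sections L A P \<pi> s =
     {f \<in> extensional (Verts A). embedding L f A P \<and> (\<forall>x\<in>Verts A. \<pi> (f x) = s x)}"

definition label_embedding where
  "label_embedding L e P \<pi> P' \<pi>' \<longleftrightarrow> embedding L e P P' \<and> (\<forall>v\<in>Verts P. \<pi>' (e v) = \<pi> v)"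

text \<open>
  A single copy of \<open>P\<close> serves all patterns in \<open>T\<close>, with one colour for each pattern.
\<close>

definition section_arrow ::
  "('r, 'f) language \<Rightarrow> ('a, 'r, 'f) lstruct \<Rightarrow> nat \<Rightarrow> ('a \<Rightarrow> 'y) set \<Rightarrow>
    ('v, 'r, 'f) lstruct \<Rightarrow> ('v \<Rightarrow> 'y) \<Rightarrow> ('w, 'r, 'f) lstruct \<Rightarrow> ('w \<Rightarrow> 'y) \<Rightarrow> bool" where
  "section_arrow L A k T P \<pi> P' \<pi>' \<longleftrightarrow>
     (\<forall>\<chi>. (\<forall>f. \<chi> f < k) \<longrightarrow>
       (\<exists>e. label_embedding L e P \<pi> P' \<pi>' \<and>
          (\<forall>s\<in>T. \<exists>c. \<forall>f\<in>sections L A P \<pi> s. \<chi> (compose (Verts A) e f) = c)))"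

lemma sections_compose:
  assumes "is_structure L A" "label_embedding L e P \<pi> P' \<pi>'" "f \<in> sections L A P \<pi> s"
  shows "compose (Verts A) e f \<in> sections L A P' \<pi>' s"
proof -
  have "embedding L (e \<circ> f) A P'"
    using assms embedding_comp by (fastforce simp: label_embedding_def sections_def)
  then have "embedding L (compose (Verts A) e f) A P'"
    using assms(1) by (rule embedding_cong) (simp add: compose_eq)
  then show ?thesis
    using assms embedding_in_Verts[of L f A P]
    by (auto simp: sections_def label_embedding_def compose_eq)
qed

lemma label_embedding_comp:
  assumes "is_structure L P" "label_embedding L e P \<pi> P' \<pi>'" "label_embedding L e' P' \<pi>' P'' \<pi>''"
  shows "label_embedding L (e' \<circ> e) P \<pi> P'' \<pi>''"
  using assms embedding_comp embedding_in_Verts unfolding label_embedding_def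
  by (metis comp_apply)

text \<open>
  To treat the label patterns in \<open>T\<close> one after the other, follow the construction backwards: the
  structure built last contains a copy of its predecessor that is good for the last pattern, and this
  copy contains one that is good for the earlier patterns.
\<close>

lemma section_arrow_iterate:
  fixes G :: "(nat, 'r, 'f) lstruct \<Rightarrow> (nat \<Rightarrow> 'y) \<Rightarrow> bool"
  assumes "finite T" and A: "is_structure L A"
    and G: "\<And>P \<pi>. G P \<pi> \<Longrightarrow> is_structure L P"
    and step: "\<And>s P \<pi>. s \<in> T \<Longrightarrow> G P \<pi> \<Longrightarrow> \<exists>P' \<pi>'. G P' \<pi>' \<and> section_arrow L A k {s} P \<pi> P' \<pi>'"
    and "G P \<pi>"
  shows "\<exists>P' \<pi>'. G P' \<pi>' \<and> section_arrow L A k T P \<pi> P' \<pi>'"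
  using assms(1) step \<open>G P \<pi>\<close>
proof (induction T rule: finite_induct)
  case empty
  have "embedding L id P P" by (simp add: embedding_def)
  then have "section_arrow L A k {} P \<pi> P \<pi>"
    by (auto simp: section_arrow_def label_embedding_def)
  with empty.prems show ?case by blast
next
  case (insert s T)
  then obtain P1 \<pi>1 where 1: "G P1 \<pi>1" "section_arrow L A k T P \<pi> P1 \<pi>1" by (metis insertCI)
  then obtain P2 \<pi>2 where 2: "G P2 \<pi>2" "section_arrow L A k {s} P1 \<pi>1 P2 \<pi>2"
    using insert.prems by (metis insertCI)
  have "section_arrow L A k (insert s T) P \<pi> P2 \<pi>2"
    unfolding section_arrow_def
  proof (intro allI impI)
    fix \<chi> :: "('a \<Rightarrow> nat) \<Rightarrow> nat" assume \<chi>: "\<forall>f. \<chi> f < k"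
    obtain e2 c where e2: "label_embedding L e2 P1 \<pi>1 P2 \<pi>2"
      and c: "\<And>f. f \<in> sections L A P1 \<pi>1 s \<Longrightarrow> \<chi> (compose (Verts A) e2 f) = c"
      using 2(2)[unfolded section_arrow_def, rule_format, of \<chi>] \<chi> by auto
    obtain e1 where e1: "label_embedding L e1 P \<pi> P1 \<pi>1"
      and T: "\<And>t. t \<in> T \<Longrightarrow>
        \<exists>c. \<forall>f\<in>sections L A P \<pi> t. \<chi> (compose (Verts A) e2 (compose (Verts A) e1 f)) = c"
      using 1(2)[unfolded section_arrow_def, rule_format, of "\<lambda>f. \<chi> (compose (Verts A) e2 f)"] \<chi>
      by auto
    have cc: "compose (Verts A) (e2 \<circ> e1) f = compose (Verts A) e2 (compose (Verts A) e1 f)" for f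
      by (auto simp: compose_def fun_eq_iff)
    have "\<chi> (compose (Verts A) (e2 \<circ> e1) f) = c" if "f \<in> sections L A P \<pi> s" for f
      using c sections_compose[OF A e1 that] by (simp add: cc)
    moreover have "label_embedding L (e2 \<circ> e1) P \<pi> P2 \<pi>2"
      using label_embedding_comp[OF G e1 e2] insert.prems by blast
    ultimately show "\<exists>e. label_embedding L e P \<pi> P2 \<pi>2 \<and>
        (\<forall>s\<in>insert s T. \<exists>c. \<forall>f\<in>sections L A P \<pi> s. \<chi> (compose (Verts A) e f) = c)"
      using T cc by (intro exI[of _ "e2 \<circ> e1"]) auto
  qed
  with 2 show ?case by blast
qed

lemma finite_sections:
  assumes "finite (Verts A)" "finite (Verts P)"
  shows "finite (sections L A P \<pi> s)"
proof (rule finite_subset)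
  show "sections L A P \<pi> s \<subseteq> Verts A \<rightarrow>\<^sub>E Verts P"
    by (auto simp: sections_def PiE_def embedding_def)
qed (use assms in \<open>auto intro: finite_PiE\<close>)

section \<open>The partite lemma\<close>

text \<open>
  Each line in a cube over the alphabet of sections gives a copy of \<open>P\<close> in a kind of power of \<open>P\<close>. A vertex \<open>v\<close>
  that lies above a vertex of \<open>A\<close>, its foot, is placed at the sequence that has \<open>v\<close> at the moving coordinates
  and the value of the section at the foot of \<open>v\<close> at the fixed ones. The other vertices are kept apart for
  different lines.
\<close>

locale line_gluing =
  fixes L :: "('r, 'f) language" and A :: "('a, 'r, 'f) lstruct" and P :: "(nat, 'r, 'f) lstruct"
    and \<pi> :: "nat \<Rightarrow> 'y" and s :: "'a \<Rightarrow> 'y" and N :: nat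
  assumes A: "is_structure L A" "finite (Verts A)"
    and P: "is_structure L P" "finite (Verts P)"
    and s: "inj_on s (Verts A)"
begin

abbreviation (input) \<Sigma> :: "('a \<Rightarrow> nat) set" where
  "\<Sigma> \<equiv> sections L A P \<pi> s"

definition above :: "nat \<Rightarrow> bool" where
  "above v \<longleftrightarrow> \<pi> v \<in> s ` Verts A"

definition foot :: "nat \<Rightarrow> 'a" where
  "foot v = inv_into (Verts A) s (\<pi> v)"

definition coord :: "('a \<Rightarrow> nat) option list \<Rightarrow> nat \<Rightarrow> nat \<Rightarrow> nat" where
  "coord \<tau> n v = (case \<tau> ! n of None \<Rightarrow> v | Some \<sigma> \<Rightarrow> \<sigma> (foot v))"

definition place :: "('a \<Rightarrow> nat) option list \<Rightarrow> nat \<Rightarrow> nat list + nat \<times> ('a \<Rightarrow> nat) option list" where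
  "place \<tau> v = (if above v then Inl (map (\<lambda>n. coord \<tau> n v) [0..<N]) else Inr (v, \<tau>))"

definition label :: "nat list + nat \<times> ('a \<Rightarrow> nat) option list \<Rightarrow> 'y" where
  "label = case_sum (\<lambda>w. \<pi> (hd w)) (\<lambda>(v, \<tau>). \<pi> v)"

lemma section_at:
  assumes "\<sigma> \<in> \<Sigma>"
  shows "embedding L \<sigma> A P" "x \<in> Verts A \<Longrightarrow> \<sigma> x \<in> Verts P" "x \<in> Verts A \<Longrightarrow> \<pi> (\<sigma> x) = s x"
    "x \<in> Verts A \<Longrightarrow> foot (\<sigma> x) = x" "x \<in> Verts A \<Longrightarrow> above (\<sigma> x)"
  using assms s by (auto simp: sections_def foot_def above_def embedding_def)

lemma foot: "above v \<Longrightarrow> foot v \<in> Verts A" "above v \<Longrightarrow> s (foot v) = \<pi> v"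
  by (auto simp: above_def foot_def inv_into_into f_inv_into_f)

lemma coord:
  assumes "\<tau> \<in> lines \<Sigma> N" "n < N" "v \<in> Verts P" "above v"
  shows "coord \<tau> n v \<in> Verts P" "\<pi> (coord \<tau> n v) = \<pi> v"
proof -
  have "\<tau> ! n \<in> set \<tau>" using assms(1,2) by (simp add: lines_def)
  then have "\<tau> ! n \<in> insert None (Some ` \<Sigma>)" using assms(1) by (auto simp: lines_def)
  then show "coord \<tau> n v \<in> Verts P" "\<pi> (coord \<tau> n v) = \<pi> v"
    using assms(3) section_at(2,3)[of _ "foot v"] foot[OF assms(4)] by (auto simp: coord_def)
qed

lemma label_place:
  assumes "\<tau> \<in> lines \<Sigma> N" "v \<in> Verts P"
  shows "label (place \<tau> v) = \<pi> v"
proof -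
  have "0 < N" using assms(1) by (auto simp: lines_def)
  then show ?thesis
    using coord(2)[OF assms(1) \<open>0 < N\<close> assms(2)] by (auto simp: label_def place_def hd_map)
qed

lemma place_eq_Inl:
  assumes "place \<tau> v = Inl w"
  shows "above v" "w = map (\<lambda>n. coord \<tau> n v) [0..<N]"
  using assms by (auto simp: place_def split: if_splits)

lemma line_moves:
  assumes "\<tau> \<in> lines \<Sigma> N"
  obtains n where "n < N" "\<tau> ! n = None"
  using assms by (auto simp: lines_def in_set_conv_nth)

lemma place_inj:
  assumes "\<tau> \<in> lines \<Sigma> N" shows "inj_on (place \<tau>) (Verts P)"
proof (rule inj_onI)
  fix v w assume eq: "place \<tau> v = place \<tau> w"
  obtain n where n: "n < N" "\<tau> ! n = None" using line_moves[OF assms] .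
  show "v = w"
  proof (cases "above v")
    case True
    then have "above w" "map (\<lambda>n. coord \<tau> n v) [0..<N] = map (\<lambda>n. coord \<tau> n w) [0..<N]"
      using eq by (auto simp: place_def split: if_splits)
    then have "coord \<tau> n v = coord \<tau> n w" using n(1) by simp
    then show ?thesis using n(2) by (simp add: coord_def)
  next
    case False
    then show ?thesis using eq by (auto simp: place_def split: if_splits)
  qed
qed

lemma map_coord_section:
  "\<tau> ! n = Some \<sigma> \<Longrightarrow> map (coord \<tau> n) xs = map \<sigma> (map foot xs)"
  "\<tau> ! n = None \<Longrightarrow> map (coord \<tau> n) xs = xs"
  by (auto simp: coord_def intro: map_idI)

lemma line_letter:
  assumes "\<tau> \<in> lines \<Sigma> N" "n < N"
  obtains "\<tau> ! n = None" | \<sigma> where "\<sigma> \<in> \<Sigma>" "\<tau> ! n = Some \<sigma>"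
proof -
  have "\<tau> ! n \<in> set \<tau>" using assms by (simp add: lines_def)
  then have "\<tau> ! n \<in> insert None (Some ` \<Sigma>)" using assms(1) by (auto simp: lines_def)
  then show thesis using that by blast
qed

text \<open>
  A vertex that is not above \<open>A\<close> identifies its line. Hence tuples that different lines place at the same spot
  lie entirely above \<open>A\<close>.
\<close>

lemma place_tuple_eqD:
  assumes \<tau>: "\<tau> \<in> lines \<Sigma> N" "\<tau>' \<in> lines \<Sigma> N"
    and V: "set xs \<subseteq> Verts P" "set ys \<subseteq> Verts P"
    and eq: "map (place \<tau>) xs = map (place \<tau>') ys"
  shows "\<tau> = \<tau>' \<and> xs = ys \<or>
    (\<forall>v\<in>set xs \<union> set ys. above v) \<and> map foot xs = map foot ys \<and>
    (\<forall>n<N. map (coord \<tau> n) xs = map (coord \<tau>' n) ys)"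
proof -
  have len: "length xs = length ys" using eq map_eq_imp_length_eq by blast
  have nth: "place \<tau> (xs ! i) = place \<tau>' (ys ! i)" if "i < length xs" for i
    using eq len that by (metis nth_map)
  show ?thesis
  proof (cases "\<forall>v\<in>set xs. above v")
    case False
    then obtain i where i: "i < length xs" "\<not> above (xs ! i)" by (auto simp: in_set_conv_nth)
    then have "\<tau> = \<tau>'" using nth[OF i(1)] by (auto simp: place_def split: if_splits)
    then have "xs = ys" using eq V place_inj[OF \<tau>(1)] by (metis (no_types) Un_least inj_on_subset map_inj_on)
    with \<open>\<tau> = \<tau>'\<close> show ?thesis by simp
  next
    case True
    have i: "above (xs ! i) \<and> above (ys ! i) \<and> foot (xs ! i) = foot (ys ! i) \<and>
        (\<forall>n<N. coord \<tau> n (xs ! i) = coord \<tau>' n (ys ! i))" if "i < length xs" for i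
    proof -
      have ax: "above (xs ! i)" using True that by simp
      then have ay: "above (ys ! i)"
        and w: "map (\<lambda>n. coord \<tau> n (xs ! i)) [0..<N] = map (\<lambda>n. coord \<tau>' n (ys ! i)) [0..<N]"
        using nth[OF that] by (auto simp: place_def split: if_splits)
      have "\<forall>n<N. coord \<tau> n (xs ! i) = coord \<tau>' n (ys ! i)" using w by auto
      moreover have "\<pi> (xs ! i) = \<pi> (ys ! i)"
        using label_place[OF \<tau>(1), of "xs ! i"] label_place[OF \<tau>(2), of "ys ! i"] nth[OF that] V that len
        by (metis nth_mem subsetD)
      ultimately show ?thesis using ax ay by (simp add: foot_def)
    qed
    then have "\<forall>v\<in>set xs \<union> set ys. above v" using len by (auto simp: in_set_conv_nth)
    moreover have "map foot xs = map foot ys" "\<forall>n<N. map (coord \<tau> n) xs = map (coord \<tau>' n) ys"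
      using i len by (auto intro!: nth_equalityI)
    ultimately show ?thesis by blast
  qed
qed

text \<open>
  If some coordinate moves in both lines, reading it shows that the tuples are equal. Otherwise a
  coordinate that moves in one line is fixed in the other, so that both tuples are images of the same
  tuple of \<open>A\<close> under sections. In either case they have the same relations and are in the same domains.
\<close>

lemma place_tuple_cases:
  assumes \<tau>: "\<tau> \<in> lines \<Sigma> N" "\<tau>' \<in> lines \<Sigma> N"
    and eq: "map foot xs = map foot ys" "\<forall>n<N. map (coord \<tau> n) xs = map (coord \<tau>' n) ys"
  obtains "xs = ys" | \<sigma> \<sigma>' where "\<sigma> \<in> \<Sigma>" "\<sigma>' \<in> \<Sigma>" "xs = map \<sigma> (map foot xs)" "ys = map \<sigma>' (map foot xs)"
proof -
  obtain n where n: "n < N" "\<tau> ! n = None" using line_moves[OF \<tau>(1)] .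
  obtain m where m: "m < N" "\<tau>' ! m = None" using line_moves[OF \<tau>(2)] .
  have xs: "xs = map (coord \<tau>' n) ys" using eq(2) n map_coord_section(2) by metis
  have ys: "ys = map (coord \<tau> m) xs" using eq(2) m map_coord_section(2) by metis
  show thesis
    using \<tau>(2) n(1)
  proof (cases rule: line_letter)
    case 1
    then show thesis using xs map_coord_section(2) that(1) by metis
  next
    case \<sigma>: (2 \<sigma>)
    show thesis
      using \<tau>(1) m(1)
    proof (cases rule: line_letter)
      case 1
      then show thesis using ys map_coord_section(2) that(1) by metis
    next
      case \<sigma>': (2 \<sigma>')
      show thesis
        using that(2)[OF \<sigma>(1) \<sigma>'(1)] xs ys map_coord_section(1)[OF \<sigma>(2)] map_coord_section(1)[OF \<sigma>'(2)] eq(1)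
        by metis
    qed
  qed
qed

lemma section_Rel_iff:
  assumes "\<sigma> \<in> \<Sigma>" "set xs \<subseteq> Verts A"
  shows "map \<sigma> xs \<in> Rel P R \<longleftrightarrow> xs \<in> Rel A R"
proof -
  have *: "xs \<in> tuples (Verts A) (rel_arity L R) \<and> R \<in> rel_symbols L"
    if "map \<sigma> xs \<in> Rel P R \<or> xs \<in> Rel A R"
    using that assms structure_Rel_rel_symbols[OF A(1)] structure_Rel_rel_symbols[OF P(1)]
      structure_Rel_tuples[OF A(1)] structure_Rel_tuples[OF P(1), of R "map \<sigma> xs"]
    by (auto simp: tuples_def)
  then show ?thesis using embedding_Rel_iff[OF section_at(1)[OF assms(1)]] by blast
qed

lemma section_dom_iff:
  assumes "\<sigma> \<in> \<Sigma>" "set xs \<subseteq> Verts A"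
  shows "map \<sigma> xs \<in> dom (Fn P F) \<longleftrightarrow> xs \<in> dom (Fn A F)"
proof -
  have *: "xs \<in> tuples (Verts A) (fun_arity L F) \<and> F \<in> fun_symbols L"
    if "map \<sigma> xs \<in> dom (Fn P F) \<or> xs \<in> dom (Fn A F)"
    using that assms structure_dom_fun_symbols[OF A(1), of xs F]
      structure_dom_fun_symbols[OF P(1), of "map \<sigma> xs" F]
      structure_dom_tuples[OF A(1), of F xs] structure_dom_tuples[OF P(1), of F "map \<sigma> xs"]
    unfolding tuples_def by auto
  then show ?thesis using embedding_dom_iff[OF section_at(1)[OF assms(1)]] by blast
qed

lemma section_Fn:
  assumes "\<sigma> \<in> \<Sigma>" "xs \<in> dom (Fn A F)"
  shows "the (Fn P F (map \<sigma> xs)) = \<sigma> (the (Fn A F xs))"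
  using embedding_Fn[OF section_at(1)[OF assms(1)] structure_dom_fun_symbols[OF A(1) assms(2)] assms(2)] .

text \<open>
  Above \<open>A\<close> the functions of \<open>P\<close> project to those of \<open>A\<close>. Without this, two lines could place a tuple at the
  same spot and its value at different spots.
\<close>

definition closed_base :: bool where
  "closed_base \<longleftrightarrow> (\<forall>F. \<forall>xs\<in>dom (Fn P F). (\<forall>v\<in>set xs. above v) \<longrightarrow>
     map foot xs \<in> dom (Fn A F) \<and> \<pi> (the (Fn P F xs)) = s (the (Fn A F (map foot xs))))"

text \<open>
  At tuples above \<open>A\<close> every coordinate map commutes with the functions of \<open>P\<close>, so that the place of the
  value is determined by the place of the tuple.
\<close>

lemma coord_Fn:
  assumes \<tau>: "\<tau> \<in> lines \<Sigma> N" "n < N" and "closed_base"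
    and xs: "xs \<in> dom (Fn P F)" "\<forall>v\<in>set xs. above v"
  shows "coord \<tau> n (the (Fn P F xs)) = the (Fn P F (map (coord \<tau> n) xs))"
    and "above (the (Fn P F xs))"
proof -
  have a: "map foot xs \<in> dom (Fn A F)" and b: "\<pi> (the (Fn P F xs)) = s (the (Fn A F (map foot xs)))"
    using assms(3) xs unfolding closed_base_def by blast+
  have y: "the (Fn A F (map foot xs)) \<in> Verts A" using structure_Fn_in_Verts[OF A(1) a] .
  then show "above (the (Fn P F xs))" using b by (auto simp: above_def)
  have ft: "foot (the (Fn P F xs)) = the (Fn A F (map foot xs))"
    using b y s by (simp add: foot_def)
  show "coord \<tau> n (the (Fn P F xs)) = the (Fn P F (map (coord \<tau> n) xs))"
    using \<tau>
  proof (cases rule: line_letter)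
    case 1
    then show ?thesis using map_coord_section(2)[OF 1] by (simp add: coord_def)
  next
    case (2 \<sigma>)
    then show ?thesis using section_Fn[OF 2(1) a] map_coord_section(1)[OF 2(2), of xs]
      by (simp add: coord_def ft del: map_map)
  qed
qed

lemma place_glueable:
  assumes "closed_base"
  shows "glueable (lines \<Sigma> N) place P"
  unfolding glueable_def
proof (intro conjI ballI allI impI place_inj; assumption?)
  fix \<tau> \<tau>' xs ys R
  assume a: "\<tau> \<in> lines \<Sigma> N" "\<tau>' \<in> lines \<Sigma> N" "set xs \<subseteq> Verts P" "set ys \<subseteq> Verts P"
    "map (place \<tau>) xs = map (place \<tau>') ys" and ys: "ys \<in> Rel P R"
  show "xs \<in> Rel P R"
  proof (cases "xs = ys")
    case False
    with place_tuple_eqD[OF a] have b: "\<forall>v\<in>set xs \<union> set ys. above v" "map foot xs = map foot ys"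
      "\<forall>n<N. map (coord \<tau> n) xs = map (coord \<tau>' n) ys" by auto
    have "set (map foot xs) \<subseteq> Verts A" using b(1) foot(1) by auto
    then show ?thesis
      using place_tuple_cases[OF a(1,2) b(2,3)] section_Rel_iff ys by metis
  qed (use ys in simp)
next
  fix \<tau> \<tau>' xs ys F
  assume a: "\<tau> \<in> lines \<Sigma> N" "\<tau>' \<in> lines \<Sigma> N" "set xs \<subseteq> Verts P" "set ys \<subseteq> Verts P"
    "map (place \<tau>) xs = map (place \<tau>') ys" and ys: "ys \<in> dom (Fn P F)"
  have "xs \<in> dom (Fn P F) \<and> place \<tau> (the (Fn P F xs)) = place \<tau>' (the (Fn P F ys))"
  proof (cases "\<tau> = \<tau>' \<and> xs = ys")
    case False
    with place_tuple_eqD[OF a] have b: "\<forall>v\<in>set xs \<union> set ys. above v" "map foot xs = map foot ys"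
      "\<forall>n<N. map (coord \<tau> n) xs = map (coord \<tau>' n) ys" by auto
    have "set (map foot xs) \<subseteq> Verts A" using b(1) foot(1) by auto
    then have xs: "xs \<in> dom (Fn P F)"
      using place_tuple_cases[OF a(1,2) b(2,3)] section_dom_iff ys by metis
    have "coord \<tau> n (the (Fn P F xs)) = coord \<tau>' n (the (Fn P F ys))" if "n < N" for n
      using coord_Fn(1)[OF a(1) that assms xs] coord_Fn(1)[OF a(2) that assms ys] b that by auto
    moreover obtain n where "n < N" using line_moves[OF a(1)] .
    then have "above (the (Fn P F xs))" "above (the (Fn P F ys))"
      using coord_Fn(2)[OF a(1) _ assms xs] coord_Fn(2)[OF a(2) _ assms ys] b(1) by auto
    ultimately show ?thesis using xs by (simp add: place_def)
  qed (use ys in simp)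
  then show "xs \<in> dom (Fn P F)" "place \<tau> (the (Fn P F xs)) = place \<tau>' (the (Fn P F ys))"
    by simp_all
qed

lemma fill_section:
  assumes "\<tau> \<in> lines \<Sigma> N" "\<sigma> \<in> \<Sigma>" "x \<in> Verts A"
  shows "place \<tau> (\<sigma> x) = Inl (map (\<lambda>\<rho>. \<rho> x) (fill \<tau> \<sigma>))"
proof -
  have "coord \<tau> n (\<sigma> x) = (map (\<lambda>\<rho>. \<rho> x) (fill \<tau> \<sigma>)) ! n" if "n < N" for n
    using assms that section_at(4)[OF assms(2,3)]
    by (auto simp: coord_def fill_def lines_def split: option.split)
  then show ?thesis
    using assms section_at(5)[OF assms(2,3)]
    by (auto simp: place_def fill_def lines_def intro!: nth_equalityI)
qed

end

text \<open>
  The set \<open>G\<close> holds the graphs of multi-valued functions on the labels, to which the labels map \<open>P\<close>.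
\<close>

definition follows ::
  "('f \<times> 'y list \<times> 'y) set \<Rightarrow> ('v, 'r, 'f) lstruct \<Rightarrow> ('v \<Rightarrow> 'y) \<Rightarrow> bool" where
  "follows G P \<pi> \<longleftrightarrow> (\<forall>F. \<forall>xs\<in>dom (Fn P F). (F, map \<pi> xs, \<pi> (the (Fn P F xs))) \<in> G)"

definition system ::
  "('r, 'f) language \<Rightarrow> ('f \<times> 'y list \<times> 'y) set \<Rightarrow> (nat, 'r, 'f) lstruct \<Rightarrow> (nat \<Rightarrow> 'y) \<Rightarrow> bool" where
  "system L G P \<pi> \<longleftrightarrow> is_structure L P \<and> finite (Verts P) \<and> follows G P \<pi>"

text \<open>
  On tuples from the image of \<open>s\<close>, the multi-valued functions take no values other than those of \<open>A\<close>.
\<close>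

definition closed_in ::
  "('a, 'r, 'f) lstruct \<Rightarrow> ('a \<Rightarrow> 'y) \<Rightarrow> ('f \<times> 'y list \<times> 'y) set \<Rightarrow> bool" where
  "closed_in A s G \<longleftrightarrow> (\<forall>F xs y. set xs \<subseteq> Verts A \<longrightarrow> (F, map s xs, y) \<in> G \<longrightarrow>
     xs \<in> dom (Fn A F) \<and> y = s (the (Fn A F xs)))"

text \<open>
  The words on a line spell out the sections inside the copy of \<open>P\<close> given by that line, and the embedding of
  \<open>A\<close> into the glued structure depends on the word alone. The Hales--Jewett theorem therefore yields the monochromatic copy. Since the labels of glued tuples are those of tuples of \<open>P\<close>, the
  result follows \<open>G\<close> again, which allows the step to be repeated.
\<close>

lemma partite_lemma_over_closed_base:
  fixes A :: "('a, 'r, 'f) lstruct" and P :: "(nat, 'r, 'f) lstruct" and \<pi> :: "nat \<Rightarrow> 'y"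
  assumes A: "is_structure L A" "finite (Verts A)" and s: "inj_on s (Verts A)"
    and sys: "system L G P \<pi>" and cl: "closed_in A s G"
  shows "\<exists>P' \<pi>'. system L G P' \<pi>' \<and> section_arrow L A k {s} P \<pi> P' \<pi>'"
proof -
  let ?\<Sigma> = "sections L A P \<pi> s"
  have P: "is_structure L P" "finite (Verts P)" using sys by (auto simp: system_def)
  have fin: "finite ?\<Sigma>" using A(2) P(2) by (rule finite_sections)
  obtain N where N: "\<And>\<chi>::('a \<Rightarrow> nat) list \<Rightarrow> nat. \<chi> ` tuples ?\<Sigma> N \<subseteq> {..<k} \<Longrightarrow>
    (\<exists>\<tau>\<in>lines ?\<Sigma> N. \<exists>c. \<forall>a\<in>?\<Sigma>. \<chi> (fill \<tau> a) = c)"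
    using Hales_Jewett[OF fin, of k] by blast
  interpret line_gluing L A P \<pi> s N using A P s by unfold_locales
  have "closed_base"
    unfolding closed_base_def
  proof (intro allI ballI impI)
    fix F xs assume xs: "xs \<in> dom (Fn P F)" "\<forall>v\<in>set xs. above v"
    have "map s (map foot xs) = map \<pi> xs" "set (map foot xs) \<subseteq> Verts A"
      using xs(2) foot by auto
    moreover have "(F, map \<pi> xs, \<pi> (the (Fn P F xs))) \<in> G"
      using sys xs(1) by (auto simp: system_def follows_def)
    ultimately show "map foot xs \<in> dom (Fn A F) \<and> \<pi> (the (Fn P F xs)) = s (the (Fn A F (map foot xs)))"
      using cl unfolding closed_in_def by metis
  qed
  from glue_into_naturals[OF P finite_lines[OF fin] place_glueable[OF this]]
  obtain U :: "(nat, 'r, 'f) lstruct" and c q where U: "is_structure L U" "finite (Verts U)"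
    and emb: "\<And>\<tau>. \<tau> \<in> lines ?\<Sigma> N \<Longrightarrow> embedding L (c \<circ> place \<tau>) P U"
    and q: "\<And>\<tau> v. \<tau> \<in> lines ?\<Sigma> N \<Longrightarrow> v \<in> Verts P \<Longrightarrow> q (c (place \<tau> v)) = place \<tau> v"
    and dom: "\<And>F zs. zs \<in> dom (Fn U F) \<Longrightarrow> \<exists>\<tau>\<in>lines ?\<Sigma> N. \<exists>xs\<in>dom (Fn P F).
       zs = map (c \<circ> place \<tau>) xs \<and> the (Fn U F zs) = c (place \<tau> (the (Fn P F xs)))"
    by blast
  let ?\<pi> = "label \<circ> q"
  have lab: "?\<pi> (c (place \<tau> v)) = \<pi> v" if "\<tau> \<in> lines ?\<Sigma> N" "v \<in> Verts P" for \<tau> v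
    using q[OF that] label_place[OF that] by simp
  have "follows G U ?\<pi>"
    unfolding follows_def
  proof (intro allI ballI)
    fix F zs assume "zs \<in> dom (Fn U F)"
    from dom[OF this] obtain \<tau> xs where \<tau>: "\<tau> \<in> lines ?\<Sigma> N" and xs: "xs \<in> dom (Fn P F)"
      and eq: "zs = map (c \<circ> place \<tau>) xs" "the (Fn U F zs) = c (place \<tau> (the (Fn P F xs)))" by blast
    have "map ?\<pi> zs = map \<pi> xs"
      using eq(1) lab[OF \<tau>] structure_tuple_subsets(2)[OF P(1) xs] by auto
    moreover have "?\<pi> (the (Fn U F zs)) = \<pi> (the (Fn P F xs))"
      using eq(2) lab[OF \<tau> structure_Fn_in_Verts[OF P(1) xs]] by simp
    ultimately show "(F, map ?\<pi> zs, ?\<pi> (the (Fn U F zs))) \<in> G"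
      using sys xs by (simp add: system_def follows_def)
  qed
  moreover have "section_arrow L A k {s} P \<pi> U ?\<pi>"
    unfolding section_arrow_def
  proof (intro allI impI)
    fix \<chi> :: "('a \<Rightarrow> nat) \<Rightarrow> nat" assume \<chi>: "\<forall>f. \<chi> f < k"
    define read where "read = (\<lambda>w. restrict (\<lambda>x. c (Inl (map (\<lambda>\<rho>. \<rho> x) w))) (Verts A))"
    have "(\<lambda>w. \<chi> (read w)) ` tuples ?\<Sigma> N \<subseteq> {..<k}" using \<chi> by auto
    from N[OF this] obtain \<tau> b where \<tau>: "\<tau> \<in> lines ?\<Sigma> N"
      and b: "\<And>\<sigma>. \<sigma> \<in> ?\<Sigma> \<Longrightarrow> \<chi> (read (fill \<tau> \<sigma>)) = b" by blast
    have "read (fill \<tau> \<sigma>) = compose (Verts A) (c \<circ> place \<tau>) \<sigma>" if "\<sigma> \<in> ?\<Sigma>" for \<sigma>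
      using fill_section[OF \<tau> that] by (auto simp: read_def compose_def fun_eq_iff)
    then have "\<chi> (compose (Verts A) (c \<circ> place \<tau>) \<sigma>) = b" if "\<sigma> \<in> ?\<Sigma>" for \<sigma>
      using b that by metis
    moreover have "label_embedding L (c \<circ> place \<tau>) P \<pi> U ?\<pi>"
      using emb[OF \<tau>] lab[OF \<tau>] by (simp add: label_embedding_def)
    ultimately show "\<exists>e. label_embedding L e P \<pi> U ?\<pi> \<and>
        (\<forall>s'\<in>{s}. \<exists>c. \<forall>f\<in>sections L A P \<pi> s'. \<chi> (compose (Verts A) e f) = c)"
      by blast
  qed
  ultimately show ?thesis using U unfolding system_def by blast
qed

text \<open>
  For an arbitrary \<open>P\<close> the union of the placed copies is only a structure \<open>D\<close> with multi-valued functions,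
  whose graphs form the set \<open>G\<close>. The words are nevertheless closed in \<open>D\<close>: a tuple of a word that some line
  hits with \<open>vs\<close> must, at a moving coordinate of the line, be \<open>vs\<close> itself, so \<open>vs\<close> lies in a section and its
  value is computed in \<open>A\<close>. The disjoint union of the copies for all lines, labelled by the vertices of \<open>D\<close>, is
  an honest structure to which the closed case applies for every word. Afterwards the colour of a
  copy of \<open>A\<close> depends only on its word, and the Hales--Jewett theorem applies.
\<close>

lemma partite_lemma:
  fixes A :: "('a, 'r, 'f) lstruct" and P :: "(nat, 'r, 'f) lstruct" and \<pi> :: "nat \<Rightarrow> 'y"
  assumes L: "is_language L" and A: "is_structure L A" "finite (Verts A)" and s: "inj_on s (Verts A)"
    and P: "is_structure L P" "finite (Verts P)"
  shows "\<exists>(P' :: (nat, 'r, 'f) lstruct) \<pi>'. is_structure L P' \<and> finite (Verts P') \<and>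
    section_arrow L A k {s} P \<pi> P' \<pi>'"
proof -
  let ?\<Sigma> = "sections L A P \<pi> s"
  have fin: "finite ?\<Sigma>" using A(2) P(2) by (rule finite_sections)
  obtain N where N: "\<And>\<chi>::('a \<Rightarrow> nat) list \<Rightarrow> nat. \<chi> ` tuples ?\<Sigma> N \<subseteq> {..<k} \<Longrightarrow>
    (\<exists>\<tau>\<in>lines ?\<Sigma> N. \<exists>c. \<forall>a\<in>?\<Sigma>. \<chi> (fill \<tau> a) = c)"
    using Hales_Jewett[OF fin, of k] by blast
  interpret line_gluing L A P \<pi> s N using A P s by unfold_locales
  let ?L = "lines ?\<Sigma> N"
  define G where "G = {(F, map (place \<tau>) xs, place \<tau> (the (Fn P F xs))) | F \<tau> xs.
    \<tau> \<in> ?L \<and> xs \<in> dom (Fn P F)}"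
  define word_section where "word_section = (\<lambda>(w :: ('a \<Rightarrow> nat) list) x. Inl (map (\<lambda>\<sigma>. \<sigma> x) w) :: nat list + nat \<times> ('a \<Rightarrow> nat) option list)"
  have closed: "closed_in A (word_section w) G" if w: "w \<in> tuples ?\<Sigma> N" for w
    unfolding closed_in_def
  proof (intro allI impI)
    fix F xs y
    assume xs: "set xs \<subseteq> Verts A" and "(F, map (word_section w) xs, y) \<in> G"
    then obtain \<tau> vs where \<tau>: "\<tau> \<in> ?L" and vs: "vs \<in> dom (Fn P F)"
      and eq: "map (word_section w) xs = map (place \<tau>) vs" and y: "y = place \<tau> (the (Fn P F vs))"
      unfolding G_def by blast
    have wn: "w ! n \<in> ?\<Sigma>" if "n < N" for n using w that by (auto simp: tuples_def)
    have lw: "length w = N" using w by (auto simp: tuples_def)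
    obtain n where n: "n < N" "\<tau> ! n = None" using line_moves[OF \<tau>] .
    have len: "length xs = length vs" using eq map_eq_imp_length_eq by blast
    have nth: "above (vs ! i)" "m < N \<Longrightarrow> coord \<tau> m (vs ! i) = (w ! m) (xs ! i)" if "i < length xs" for i m
    proof -
      have "place \<tau> (vs ! i) = Inl (map (\<lambda>\<sigma>. \<sigma> (xs ! i)) w)"
        using eq len that by (metis nth_map word_section_def)
      from place_eq_Inl[OF this] show "above (vs ! i)"
        "m < N \<Longrightarrow> coord \<tau> m (vs ! i) = (w ! m) (xs ! i)"
        using lw by (auto dest!: arg_cong[of _ _ "\<lambda>l. l ! m"])
    qed
    have coords: "map (coord \<tau> m) vs = map (w ! m) xs" if "m < N" for m
      using nth(2) len that by (auto intro!: nth_equalityI)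
    \<comment> \<open>Read off a moving coordinate of the line: the tuple lies in the section \<open>w ! n\<close>.\<close>
    have vs_n: "vs = map (w ! n) xs" using coords[OF n(1)] map_coord_section(2)[OF n(2)] by metis
    have feet: "map foot vs = xs"
      using xs section_at(4)[OF wn[OF n(1)]] unfolding vs_n by (auto intro!: map_idI)
    have xd: "xs \<in> dom (Fn A F)"
      using vs section_dom_iff[OF wn[OF n(1)] xs] unfolding vs_n by blast
    let ?u = "the (Fn P F vs)" and ?y = "the (Fn A F xs)"
    have val: "the (Fn P F (map (w ! m) xs)) = (w ! m) ?y" if "m < N" for m
      using section_Fn[OF wn[OF that] xd] .
    have yA: "?y \<in> Verts A" using structure_Fn_in_Verts[OF A(1) xd] .
    have u: "?u = (w ! n) ?y" using val[OF n(1)] vs_n by simp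
    have above_u: "above ?u" "foot ?u = ?y"
      unfolding u using section_at(4,5)[OF wn[OF n(1)] yA] by auto
    have "coord \<tau> m ?u = (w ! m) ?y" if m: "m < N" for m
      using \<tau> m
    proof (cases rule: line_letter)
      case 1
      then have "?u = (w ! m) ?y" using val[OF m] coords[OF m] map_coord_section(2)[OF 1] by metis
      then show ?thesis using 1 by (simp add: coord_def)
    next
      case (2 \<sigma>)
      have "\<sigma> ?y = the (Fn P F (map (coord \<tau> m) vs))"
        using section_Fn[OF 2(1) xd] map_coord_section(1)[OF 2(2), of vs] feet by metis
      then show ?thesis using 2(2) above_u val[OF m] coords[OF m] by (simp add: coord_def)
    qed
    then have "y = word_section w ?y"
      using above_u(1) lw by (auto simp: y place_def word_section_def intro!: nth_equalityI)
    with xd show "xs \<in> dom (Fn A F) \<and> y = word_section w (the (Fn A F xs))" by simp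
  qed
  define tagged where "tagged = (\<lambda>(\<tau> :: ('a \<Rightarrow> nat) option list) (v :: nat). (v, \<tau>))"
  have "glueable ?L tagged P"
    using P(1) L by (intro glueable_disjoint) (auto simp: tagged_def intro: inj_onI)
  from glue_into_naturals[OF P finite_lines[OF fin] this]
  obtain Q :: "(nat, 'r, 'f) lstruct" and c q where Q: "is_structure L Q" "finite (Verts Q)"
    and emb: "\<And>\<tau>. \<tau> \<in> ?L \<Longrightarrow> embedding L (c \<circ> tagged \<tau>) P Q"
    and q: "\<And>\<tau> v. \<tau> \<in> ?L \<Longrightarrow> v \<in> Verts P \<Longrightarrow> q (c (tagged \<tau> v)) = tagged \<tau> v"
    and dom: "\<And>F zs. zs \<in> dom (Fn Q F) \<Longrightarrow> \<exists>\<tau>\<in>?L. \<exists>xs\<in>dom (Fn P F).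
       zs = map (c \<circ> tagged \<tau>) xs \<and> the (Fn Q F zs) = c (tagged \<tau> (the (Fn P F xs)))"
    by blast
  define p where "p = (\<lambda>u. place (snd (q u)) (fst (q u)))"
  have p: "p (c (tagged \<tau> v)) = place \<tau> v" if "\<tau> \<in> ?L" "v \<in> Verts P" for \<tau> v
    using q[OF that] by (simp add: p_def tagged_def)
  have "follows G Q p"
    unfolding follows_def
  proof (intro allI ballI)
    fix F zs assume "zs \<in> dom (Fn Q F)"
    from dom[OF this] obtain \<tau> xs where \<tau>: "\<tau> \<in> ?L" and xs: "xs \<in> dom (Fn P F)"
      and eq: "zs = map (c \<circ> tagged \<tau>) xs" "the (Fn Q F zs) = c (tagged \<tau> (the (Fn P F xs)))" by blast
    have "map p zs = map (place \<tau>) xs"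
      using eq(1) p[OF \<tau>] structure_tuple_subsets(2)[OF P(1) xs] by auto
    moreover have "p (the (Fn Q F zs)) = place \<tau> (the (Fn P F xs))"
      using eq(2) p[OF \<tau> structure_Fn_in_Verts[OF P(1) xs]] by simp
    ultimately show "(F, map p zs, p (the (Fn Q F zs))) \<in> G"
      using \<tau> xs by (auto simp: G_def)
  qed
  then have sysQ: "system L G Q p" using Q by (simp add: system_def)
  show ?thesis
  proof (cases "N = 0")
    case True
    then have "?L = {}" by (auto simp: lines_def)
    \<comment> \<open>A cube of dimension zero contains no line, so its only word cannot have been coloured.\<close>
    then have "k = 0" using N[of "\<lambda>_. 0"] by fastforce
    then have "section_arrow L A k {s} P \<pi> P \<pi>" by (simp add: section_arrow_def)
    then show ?thesis using P by blast
  next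
    case False
    have inj: "inj_on (word_section w) (Verts A)" if w: "w \<in> tuples ?\<Sigma> N" for w
    proof (rule inj_onI)
      fix x y assume xy: "x \<in> Verts A" "y \<in> Verts A" "word_section w x = word_section w y"
      have len: "0 < length w" using w False by (simp add: tuples_def)
      then have w0: "w ! 0 \<in> ?\<Sigma>" using w nth_mem[of 0 w] by (auto simp: tuples_def)
      have "\<forall>\<sigma>\<in>set w. \<sigma> x = \<sigma> y" using xy(3) by (simp add: word_section_def)
      then have "(w ! 0) x = (w ! 0) y" using len nth_mem by blast
      with w0 show "x = y" using xy(1,2) section_at(4) by metis
    qed
    have "\<exists>P' p'. system L G P' p' \<and> section_arrow L A k (word_section ` tuples ?\<Sigma> N) Q p P' p'"
    proof (rule section_arrow_iterate[where G = "system L G", OF _ A(1) _ _ sysQ])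
      show "finite (word_section ` tuples ?\<Sigma> N)" using finite_tuples[OF fin] by blast
      show "is_structure L P'" if "system L G P' p'" for P' p'
        using that by (simp add: system_def)
      show "\<exists>P' p'. system L G P' p' \<and> section_arrow L A k {t} P1 p1 P' p'"
        if "t \<in> word_section ` tuples ?\<Sigma> N" "system L G P1 p1" for t P1 p1
        using that closed inj partite_lemma_over_closed_base[OF A _ that(2)] by blast
    qed
    then obtain P' p' where P': "system L G P' p'"
      and arr: "section_arrow L A k (word_section ` tuples ?\<Sigma> N) Q p P' p'" by blast
    have "section_arrow L A k {s} P \<pi> P' (label \<circ> p')"
      unfolding section_arrow_def
    proof (intro allI impI)
      fix \<chi> :: "('a \<Rightarrow> nat) \<Rightarrow> nat" assume \<chi>: "\<forall>f. \<chi> f < k"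
      obtain e where e: "label_embedding L e Q p P' p'"
        and mono: "\<And>w. w \<in> tuples ?\<Sigma> N \<Longrightarrow>
          \<exists>b. \<forall>f\<in>sections L A Q p (word_section w). \<chi> (compose (Verts A) e f) = b"
        using arr[unfolded section_arrow_def, rule_format, of \<chi>] \<chi> by blast
      define col where "col = (\<lambda>w. \<chi> (compose (Verts A) e (SOME f. f \<in> sections L A Q p (word_section w))))"
      have col: "\<chi> (compose (Verts A) e f) = col w"
        if "w \<in> tuples ?\<Sigma> N" "f \<in> sections L A Q p (word_section w)" for w f
        using mono[OF that(1)] that(2) someI[of "\<lambda>f. f \<in> sections L A Q p (word_section w)" f]
        unfolding col_def by metis
      have "col ` tuples ?\<Sigma> N \<subseteq> {..<k}" using \<chi> by (auto simp: col_def)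
      from N[OF this] obtain \<tau> b where \<tau>: "\<tau> \<in> ?L"
        and b: "\<And>\<sigma>. \<sigma> \<in> ?\<Sigma> \<Longrightarrow> col (fill \<tau> \<sigma>) = b" by blast
      let ?h = "c \<circ> tagged \<tau>"
      have h: "label_embedding L ?h P (place \<tau>) Q p"
        using emb[OF \<tau>] p[OF \<tau>] by (simp add: label_embedding_def)
      have sec: "compose (Verts A) ?h \<sigma> \<in> sections L A Q p (word_section (fill \<tau> \<sigma>))" if "\<sigma> \<in> ?\<Sigma>" for \<sigma>
      proof (rule sections_compose[OF A(1) h])
        show "\<sigma> \<in> sections L A P (place \<tau>) (word_section (fill \<tau> \<sigma>))"
          using that fill_section[OF \<tau> that] by (simp add: sections_def word_section_def)
      qed
      have "\<chi> (compose (Verts A) (e \<circ> ?h) \<sigma>) = b" if "\<sigma> \<in> ?\<Sigma>" for \<sigma>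
      proof -
        have "compose (Verts A) (e \<circ> ?h) \<sigma> = compose (Verts A) e (compose (Verts A) ?h \<sigma>)"
          by (auto simp: compose_def fun_eq_iff)
        then show ?thesis
          using col[OF fill_in_tuples[OF \<tau> that] sec[OF that]] b[OF that] by metis
      qed
      moreover have "label_embedding L (e \<circ> ?h) P \<pi> P' (label \<circ> p')"
        using label_embedding_comp[OF P(1) h e] label_place[OF \<tau>] by (simp add: label_embedding_def)
      ultimately show "\<exists>e. label_embedding L e P \<pi> P' (label \<circ> p') \<and>
          (\<forall>s'\<in>{s}. \<exists>b. \<forall>f\<in>sections L A P \<pi> s'. \<chi> (compose (Verts A) e f) = b)"
        by blast
    qed
    then show ?thesis using P' unfolding system_def by blast
  qed
qed

section \<open>Ordered structures\<close>

text \<open>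
  The rank of an element is the number of its strict predecessors.
\<close>

lemma linear_order_rank:
  assumes "finite V" "linear_order_on V {(x, y). Q x y}"
  obtains r where "bij_betw r V {..<card V}"
    "\<And>x y. x \<in> V \<Longrightarrow> y \<in> V \<Longrightarrow> Q x y \<longleftrightarrow> r x \<le> (r y :: nat)"
proof -
  let ?R = "{(x, y). Q x y}"
  have refl: "\<And>x. x \<in> V \<Longrightarrow> (x, x) \<in> ?R" and tr: "trans ?R" and anti: "antisym ?R"
    and tot: "\<And>x y. x \<in> V \<Longrightarrow> y \<in> V \<Longrightarrow> x \<noteq> y \<Longrightarrow> (x, y) \<in> ?R \<or> (y, x) \<in> ?R"
    using assms(2) by (auto simp: order_on_defs refl_on_def total_on_def)
  define S where "S = (\<lambda>x. {z \<in> V. (z, x) \<in> ?R \<and> z \<noteq> x})"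
  define r where "r = (\<lambda>x. card (S x))"
  have less: "r x < r y" if "x \<in> V" "y \<in> V" "(x, y) \<in> ?R" "x \<noteq> y" for x y
  proof -
    have "S x \<subset> S y"
      using that tr anti unfolding S_def trans_def antisym_def by blast
    then show ?thesis using assms(1) by (auto simp: r_def S_def intro: psubset_card_mono)
  qed
  have iff: "(x, y) \<in> ?R \<longleftrightarrow> r x \<le> r y" if "x \<in> V" "y \<in> V" for x y
    using that refl tot less by (metis leD less_imp_le order_refl)
  have "r x < card V" if "x \<in> V" for x
    unfolding r_def by (rule psubset_card_mono[OF assms(1)]) (use that in \<open>auto simp: S_def\<close>)
  moreover have "inj_on r V" using less tot by (metis inj_onI less_irrefl)
  ultimately have "bij_betw r V {..<card V}"
    by (intro bij_betw_imageI card_subset_eq) (auto simp: card_image)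
  then show ?thesis using that iff by simp
qed

lemma monotone_eq_sorted_enumeration:
  fixes g :: "'a \<Rightarrow> nat"
  assumes r: "bij_betw r V {..<card V}"
    and g: "\<And>x y. x \<in> V \<Longrightarrow> y \<in> V \<Longrightarrow> r x < r y \<Longrightarrow> g x < g y"
    and "x \<in> V"
  shows "g x = sorted_list_of_set (g ` V) ! r x"
proof -
  have fin: "finite V" using r bij_betw_finite by blast
  let ?i = "inv_into V r"
  have i: "?i n \<in> V" "r (?i n) = n" if "n < card V" for n
    using that r by (auto simp: bij_betw_def inv_into_into f_inv_into_f)
  let ?l = "map (\<lambda>n. g (?i n)) [0..<card V]"
  have "sorted_wrt (<) ?l"
    using i g by (auto simp: sorted_wrt_iff_nth_less)
  moreover have "set ?l = g ` V"
  proof -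
    have "?i ` {..<card V} = V" using bij_betw_inv_into[OF r] by (simp add: bij_betw_def)
    then show ?thesis by (auto simp: image_image[symmetric] atLeast0LessThan)
  qed
  ultimately have "sorted_list_of_set (g ` V) = ?l"
    using fin by (intro strict_sorted_equal) auto
  moreover have "r x < card V" using r assms(3) by (auto simp: bij_betw_def)
  moreover have "?i (r x) = x" using r assms(3) by (auto simp: bij_betw_def)
  ultimately show ?thesis by simp
qed

text \<open>
  Start with the disjoint union of copies of \<open>B\<close>, one for each subset \<open>X\<close> of \<open>{..<N}\<close> of the size of \<open>B\<close>, in
  which the label of a vertex is the element of \<open>X\<close> at its position in \<open>B\<close>. Apply the partite lemma to the
  increasing label patterns of \<open>A\<close>, one for each subset of \<open>{..<N}\<close> of the size of \<open>A\<close>. The colour of a copy of \<open>A\<close>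
  then depends only on its set of labels, and Ramsey's theorem yields a set \<open>X\<close> whose copy of \<open>B\<close> is
  monochromatic.

  The relation \<open>le\<close> of the structure so obtained need not be a linear order. It is replaced by a linear
  order that refines the order of the labels. This does not affect the relevant copies of \<open>A\<close> and \<open>B\<close>, as
  their labels increase along their orders.
\<close>

lemma ordered_structures_arrow:
  fixes L :: "('r, 'f) language" and A B :: "('v, 'r, 'f) lstruct"
  assumes L: "is_language L" and le: "le \<in> rel_symbols L" "rel_arity L le = 2"
    and inf: "infinite (UNIV :: 'v set)"
    and A: "A \<in> ordered_structures L le" and B: "B \<in> ordered_structures L le" and k: "k \<ge> 1"
  shows "\<exists>C\<in>ordered_structures L le. ramsey_arrow L C B A k"
proof -
  have A': "is_structure L A" "finite (Verts A)" and lA: "linear_order_on (Verts A) {(x, y). [x, y] \<in> Rel A le}"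
    using A by (auto simp: ordered_structures_def)
  have B': "is_structure L B" "finite (Verts B)" and lB: "linear_order_on (Verts B) {(x, y). [x, y] \<in> Rel B le}"
    using B by (auto simp: ordered_structures_def)
  obtain rA where rA: "bij_betw rA (Verts A) {..<card (Verts A)}"
    and rA_le: "\<And>x y. x \<in> Verts A \<Longrightarrow> y \<in> Verts A \<Longrightarrow> [x, y] \<in> Rel A le \<longleftrightarrow> rA x \<le> rA y"
    using linear_order_rank[OF A'(2) lA] by blast
  obtain rB where rB: "bij_betw rB (Verts B) {..<card (Verts B)}"
    and rB_le: "\<And>x y. x \<in> Verts B \<Longrightarrow> y \<in> Verts B \<Longrightarrow> [x, y] \<in> Rel B le \<longleftrightarrow> rB x \<le> rB y"
    using linear_order_rank[OF B'(2) lB] by blast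
  let ?a = "card (Verts A)" and ?b = "card (Verts B)"
  obtain N :: nat where N: "partn_lst {..<N} (replicate k ?b) ?a" using ramsey_full by blast
  let ?I = "nsets {..<N} ?b"
  define pos where "pos = (\<lambda>(r :: 'v \<Rightarrow> nat) (X :: nat set) x. sorted_list_of_set X ! r x)"
  have pos_less: "pos r X x < pos r X y"
    if "X \<in> nsets {..<N} n" "r x < r y" "r y < n" for r X n and x y :: 'v
  proof -
    have X: "finite X" "card X = n" using that by (auto simp: nsets_def)
    have "sorted_wrt (<) (sorted_list_of_set X)" by simp
    then show ?thesis using that X by (simp add: pos_def sorted_wrt_iff_nth_less)
  qed
  have pos_in: "pos r X x \<in> X" if "X \<in> nsets {..<N} n" "r x < n" for r X n and x :: 'v
    using that nth_mem[of "r x" "sorted_list_of_set X"] by (auto simp: pos_def nsets_def)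
  have rB_lt: "rB x < ?b" if "x \<in> Verts B" for x using rB that by (auto simp: bij_betw_def)
  have rA_lt: "rA x < ?a" if "x \<in> Verts A" for x using rA that by (auto simp: bij_betw_def)
  define tagged where "tagged = (\<lambda>(X :: nat set) (v :: 'v). (v, X))"
  have "glueable ?I tagged B"
    using B'(1) L by (intro glueable_disjoint) (auto simp: tagged_def intro: inj_onI)
  from glue_into_naturals[OF B' finite_imp_finite_nsets this]
  obtain Q :: "(nat, 'r, 'f) lstruct" and c q where Q: "is_structure L Q" "finite (Verts Q)"
    and embQ: "\<And>X. X \<in> ?I \<Longrightarrow> embedding L (c \<circ> tagged X) B Q"
    and q: "\<And>X v. X \<in> ?I \<Longrightarrow> v \<in> Verts B \<Longrightarrow> q (c (tagged X v)) = tagged X v"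
    by (metis finite_lessThan)
  define p where "p = (\<lambda>u. pos rB (snd (q u)) (fst (q u)))"
  have p: "p (c (tagged X v)) = pos rB X v" if "X \<in> ?I" "v \<in> Verts B" for X v
    using q[OF that] by (simp add: p_def tagged_def)
  define T where "T = pos rA ` nsets {..<N} ?a"
  have "\<exists>(P :: (nat, 'r, 'f) lstruct) \<pi>. (is_structure L P \<and> finite (Verts P)) \<and> section_arrow L A k T Q p P \<pi>"
  proof (rule section_arrow_iterate[where G = "\<lambda>P \<pi>. is_structure L P \<and> finite (Verts P)"])
    show "finite T" by (simp add: T_def finite_imp_finite_nsets)
    fix s and P1 :: "(nat, 'r, 'f) lstruct" and \<pi>1 :: "nat \<Rightarrow> nat"
    assume "s \<in> T" and P1: "is_structure L P1 \<and> finite (Verts P1)"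
    then obtain S where S: "S \<in> nsets {..<N} ?a" "s = pos rA S" by (auto simp: T_def)
    have "inj_on s (Verts A)"
    proof (rule inj_onI, rule ccontr)
      fix x y assume xy: "x \<in> Verts A" "y \<in> Verts A" "s x = s y" "x \<noteq> y"
      then have "rA x \<noteq> rA y" using rA by (auto simp: bij_betw_def inj_on_def)
      then have "s x < s y \<or> s y < s x"
        using pos_less[OF S(1)] rA_lt xy(1,2) S(2) by (metis linorder_neqE_nat)
      then show False using xy(3) by simp
    qed
    then show "\<exists>(P' :: (nat, 'r, 'f) lstruct) \<pi>'. (is_structure L P' \<and> finite (Verts P')) \<and> section_arrow L A k {s} P1 \<pi>1 P' \<pi>'"
      using partite_lemma[OF L A' _ conjunct1[OF P1] conjunct2[OF P1]] by blast
  qed (use A' Q in auto)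
  then obtain P :: "(nat, 'r, 'f) lstruct" and \<pi> where P: "is_structure L P" "finite (Verts P)"
    and arr: "section_arrow L A k T Q p P \<pi>" by blast
  obtain g :: "nat \<Rightarrow> 'v" where g: "inj g" using infinite_countable_subset[OF inf] by blast
  define U where "U = glue {()} (\<lambda>_. g) P"
  have gl: "glueable {()} (\<lambda>_. g) P"
    using inj_on_subset[OF g subset_UNIV] by (intro glueable_disjoint[OF _ _ P(1) L]) simp_all
  have U: "is_structure L U" "embedding L g P U"
    using glue_structure[OF P(1) gl] glue_embedding[OF P(1) gl] by (auto simp: U_def)
  have VU: "Verts U = g ` Verts P" by (simp add: U_def glue_def)
  obtain M where M: "\<And>u. u \<in> Verts P \<Longrightarrow> u < M"
    using finite_nat_set_iff_bounded[THEN iffD1, OF P(2)] by auto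
  \<comment> \<open>The key compares labels first and breaks ties by the vertices themselves.\<close>
  define key where "key = (\<lambda>x. \<pi> (inv g x) * M + inv g x)"
  have key_g: "key (g u) = \<pi> u * M + u" for u using g by (simp add: key_def)
  have key_less: "key (g u) < key (g u')" if "u \<in> Verts P" "u' \<in> Verts P" "\<pi> u < \<pi> u'" for u u'
  proof -
    have "key (g u) < (\<pi> u + 1) * M" using M[OF that(1)] by (simp add: key_g)
    also have "\<dots> \<le> \<pi> u' * M" using that(3) by (intro mult_right_mono) auto
    also have "\<dots> \<le> key (g u')" by (simp add: key_g)
    finally show ?thesis .
  qed
  have key_inj: "x = y" if xy: "x \<in> Verts U" "y \<in> Verts U" "key x = key y" for x y
  proof -
    obtain u u' where u: "x = g u" "u \<in> Verts P" "y = g u'" "u' \<in> Verts P"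
      using xy(1,2) by (auto simp: VU)
    then have "\<pi> u = \<pi> u'" using key_less[OF u(2,4)] key_less[OF u(4,2)] xy(3)
      by (metis linorder_neqE_nat less_irrefl)
    then show ?thesis using xy(3) u by (simp add: key_g)
  qed
  define lex where "lex = {[x, y] | x y. x \<in> Verts U \<and> y \<in> Verts U \<and> key x \<le> key y}"
  define C where "C = U\<lparr>Rel := (Rel U)(le := lex)\<rparr>"
  have C_simps: "Verts C = Verts U" "Fn C = Fn U" "Rel C R = (if R = le then lex else Rel U R)" for R
    by (simp_all add: C_def)
  have C: "is_structure L C"
    using U(1) le unfolding is_structure_def C_simps by (auto simp: lex_def tuples_def)
  have "{(x, y). [x, y] \<in> Rel C le} = {(x, y). x \<in> Verts C \<and> y \<in> Verts C \<and> key x \<le> key y}"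
    by (auto simp: C_simps lex_def)
  moreover have "linear_order_on (Verts C) {(x, y). x \<in> Verts C \<and> y \<in> Verts C \<and> key x \<le> key y}"
    using key_inj unfolding C_simps order_on_defs refl_on_def trans_def antisym_def total_on_def
    by (auto intro: le_antisym)
  ultimately have C_ord: "C \<in> ordered_structures L le"
    using C P(2) by (simp add: ordered_structures_def C_simps(1) VU)
  \<comment> \<open>Embeddings whose labels increase with the order survive the change of \<open>le\<close>.\<close>
  have reorder: "embedding L (g \<circ> h) D C"
    if D: "is_structure L D" and h: "embedding L h D P"
      and r: "inj_on r (Verts D)"
        "\<And>x y. x \<in> Verts D \<Longrightarrow> y \<in> Verts D \<Longrightarrow> [x, y] \<in> Rel D le \<longleftrightarrow> r x \<le> (r y :: nat)"
        "\<And>x y. x \<in> Verts D \<Longrightarrow> y \<in> Verts D \<Longrightarrow> r x < r y \<Longrightarrow> \<pi> (h x) < \<pi> (h y)"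
    for D :: "('v, 'r, 'f) lstruct" and h r
  proof -
    have gh: "embedding L (g \<circ> h) D U" using embedding_comp[OF h U(2) D] .
    have "xs \<in> Rel D le \<longleftrightarrow> map (g \<circ> h) xs \<in> lex" if pair: "xs \<in> tuples (Verts D) 2" for xs
    proof -
      obtain x y where xs: "xs = [x, y]" "x \<in> Verts D" "y \<in> Verts D"
        using pair by (auto simp: tuples_def length_Suc_conv numeral_2_eq_2)
      have hV: "h x \<in> Verts P" "h y \<in> Verts P" using embedding_in_Verts[OF h] xs by auto
      have "r x \<le> r y \<longleftrightarrow> key (g (h x)) \<le> key (g (h y))"
      proof (cases "r x" "r y" rule: linorder_cases)
        case less
        then show ?thesis using key_less[OF hV] r(3)[OF xs(2,3)] by simp
      next
        case equal
        then have "x = y" using r(1) xs by (auto simp: inj_on_def)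
        then show ?thesis by simp
      next
        case greater
        then show ?thesis using key_less[OF hV(2,1)] r(3)[OF xs(3,2)] by force
      qed
      then show ?thesis using r(2) xs hV by (auto simp: lex_def VU)
    qed
    then show ?thesis using gh le(2) unfolding embedding_def C_simps by (auto simp del: map_map)
  qed
  have "ramsey_arrow L C B A k"
    unfolding ramsey_arrow_def
  proof (intro allI impI, elim conjE)
    fix Pt :: "nat \<Rightarrow> ('v, 'r, 'f) lstruct set"
    assume cover: "(\<Union>i<k. Pt i) = copies L C A"
      and disj: "\<forall>i<k. \<forall>j<k. i \<noteq> j \<longrightarrow> Pt i \<inter> Pt j = {}"
    \<comment> \<open>The index of the class of a copy; 0 stands for substructures that are not copies of \<open>A\<close>.\<close>
    define idx where "idx = (\<lambda>S. if \<exists>i<k. S \<in> Pt i then SOME i. i < k \<and> S \<in> Pt i else 0)"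
    have idx: "idx S = i" if "i < k" "S \<in> Pt i" for i S
    proof -
      have "(SOME i. i < k \<and> S \<in> Pt i) < k \<and> S \<in> Pt (SOME i. i < k \<and> S \<in> Pt i)"
        by (rule someI[of "\<lambda>i. i < k \<and> S \<in> Pt i" i]) (use that in blast)
      then show ?thesis using that disj unfolding idx_def by (metis disjoint_iff)
    qed
    have idx_less: "idx S < k" for S
    proof (cases "\<exists>i<k. S \<in> Pt i")
      case True
      then show ?thesis using idx by blast
    next
      case False
      then have "idx S = 0" unfolding idx_def by meson
      then show ?thesis using k by simp
    qed
    define \<chi> where "\<chi> = (\<lambda>f. idx (induced C (g ` f ` Verts A)))"
    obtain e where e: "label_embedding L e Q p P \<pi>"
      and mono: "\<And>s. s \<in> T \<Longrightarrow> \<exists>b. \<forall>f\<in>sections L A Q p s. \<chi> (compose (Verts A) e f) = b"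
      using arr[unfolded section_arrow_def, rule_format, of \<chi>] idx_less by (auto simp: \<chi>_def)
    have "\<forall>S\<in>nsets {..<N} ?a. \<exists>b. \<forall>f\<in>sections L A Q p (pos rA S). \<chi> (compose (Verts A) e f) = b"
      using mono by (simp add: T_def)
    then obtain b where b: "\<And>S f. S \<in> nsets {..<N} ?a \<Longrightarrow> f \<in> sections L A Q p (pos rA S) \<Longrightarrow>
        \<chi> (compose (Verts A) e f) = b S" by metis
    define col where "col = (\<lambda>S. if b S < k then b S else 0)"
    have "col \<in> nsets {..<N} ?a \<rightarrow> {..<k}" using k by (auto simp: col_def)
    then obtain i X where i: "i < k" and X: "X \<in> ?I" and colX: "col ` nsets X ?a \<subseteq> {i}"
      using N unfolding partn_lst_def monochromatic_def by fastforce
    let ?m = "e \<circ> (c \<circ> tagged X)"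
    have em: "embedding L ?m B P"
      using embedding_comp[OF embQ[OF X] _ B'(1)] e unfolding label_embedding_def by blast
    have pm: "\<pi> (?m v) = pos rB X v" if "v \<in> Verts B" for v
      using e p[OF X that] embedding_in_Verts[OF embQ[OF X] that] by (simp add: label_embedding_def)
    have gm: "embedding L (g \<circ> ?m) B C"
    proof (rule reorder[OF B'(1) em])
      show "inj_on rB (Verts B)" using rB by (simp add: bij_betw_def)
      show "[x, y] \<in> Rel B le \<longleftrightarrow> rB x \<le> rB y" if "x \<in> Verts B" "y \<in> Verts B" for x y
        using rB_le that .
      show "\<pi> (?m x) < \<pi> (?m y)" if "x \<in> Verts B" "y \<in> Verts B" "rB x < rB y" for x y
        using pm that pos_less[OF X that(3)] rB_lt by simp
    qed
    define BC where "BC = induced C ((g \<circ> ?m) ` Verts B)"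
    have BC: "substructure L BC C" "embedding L (g \<circ> ?m) B BC" "BC \<in> copies L C B"
      using induced_image[OF B'(1) C gm] by (simp_all add: BC_def)
    have VBC: "(g \<circ> ?m) ` Verts B = Verts BC" by (simp add: BC_def induced_simps)
    have "S \<in> Pt i" if S: "S \<in> copies L BC A" for S
    proof -
      have sub: "substructure L S BC" using S by (simp add: copies_def)
      obtain f0 where f0: "embedding L f0 A S" "f0 ` Verts A = Verts S"
        using S by (auto simp: copies_def isomorphic_def)
      have SC: "substructure L S C" using substructure_trans[OF sub BC(1)] .
      then have "S \<in> copies L C A" using S by (simp add: copies_def)
      then obtain j where j: "j < k" "S \<in> Pt j" using cover by blast
      let ?n = "inv_into (Verts B) (g \<circ> ?m)"
      define f where "f = ?n \<circ> f0"
      have f0BC: "embedding L f0 A BC"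
        using embedding_comp[OF f0(1) _ A'(1), of id BC] sub by (simp add: substructure_def)
      have "is_structure L BC" using BC(1) by (simp add: substructure_def)
      from embedding_inverse[OF B'(1) this BC(2) VBC]
      have f: "embedding L f A B" unfolding f_def by (rule embedding_comp[OF f0BC _ A'(1)])
      have f0_eq: "(g \<circ> ?m) (f x) = f0 x" if "x \<in> Verts A" for x
        using f_inv_into_f[of "f0 x" "g \<circ> ?m" "Verts B"] embedding_in_Verts[OF f0BC that] VBC
        by (simp add: f_def)
      have fV: "f x \<in> Verts B" if "x \<in> Verts A" for x using embedding_in_Verts[OF f that] .
      have f_mono: "rB (f x) < rB (f y)" if "x \<in> Verts A" "y \<in> Verts A" "rA x < rA y" for x y
      proof -
        have "[y, x] \<in> Rel A le \<longleftrightarrow> [f y, f x] \<in> Rel B le"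
          using embedding_Rel_iff[OF f le(1), of "[y, x]"] le(2) that by (simp add: tuples_def)
        then show ?thesis using rA_le[OF that(2,1)] rB_le[OF fV[OF that(2)] fV[OF that(1)]] that(3) by simp
      qed
      let ?t = "\<lambda>x. pos rB X (f x)"
      have t_mono: "?t x < ?t y" if "x \<in> Verts A" "y \<in> Verts A" "rA x < rA y" for x y
        by (rule pos_less[OF X]) (use f_mono[OF that] rB_lt fV that in auto)
      let ?S = "?t ` Verts A"
      have t_eq: "?t x = pos rA ?S x" if "x \<in> Verts A" for x
        using monotone_eq_sorted_enumeration[OF rA t_mono that] unfolding pos_def .
      have "inj_on ?t (Verts A)"
      proof (rule inj_onI, rule ccontr)
        fix x y assume xy: "x \<in> Verts A" "y \<in> Verts A" "?t x = ?t y" "x \<noteq> y"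
        then have "rA x \<noteq> rA y" using rA by (auto simp: bij_betw_def inj_on_def)
        then show False using t_mono xy by (metis less_irrefl linorder_neqE_nat)
      qed
      then have SX: "?S \<in> nsets X ?a"
        using pos_in[OF X] rB_lt fV A'(2) by (auto simp: nsets_def card_image)
      then have SN: "?S \<in> nsets {..<N} ?a" using X by (auto simp: nsets_def)
      let ?f = "compose (Verts A) (c \<circ> tagged X) f"
      have "embedding L ?f A Q"
        by (rule embedding_cong[OF embedding_comp[OF f embQ[OF X] A'(1)] A'(1)]) (simp add: compose_eq)
      then have "?f \<in> sections L A Q p (pos rA ?S)"
        using p[OF X fV] t_eq by (simp add: sections_def compose_eq)
      from b[OF SN this] have "\<chi> (compose (Verts A) e ?f) = b ?S" .
      moreover have "g ` compose (Verts A) e ?f ` Verts A = f0 ` Verts A"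
        using f0_eq by (auto simp: compose_eq image_image)
      then have "\<chi> (compose (Verts A) e ?f) = j"
        using idx[OF j] substructure_eq_induced[OF SC] f0(2) by (simp add: \<chi>_def)
      ultimately have "b ?S = j" by simp
      then have "col ?S = j" using j by (simp add: col_def)
      then show ?thesis using colX SX j(2) by auto
    qed
    then show "\<exists>B'\<in>copies L C B. \<exists>i<k. copies L B' A \<subseteq> Pt i"
      using BC(3) i by blast
  qed
  with C_ord show ?thesis by blast
qed

theorem theorem2p19:
  fixes L :: "('r, 'f) language" and le :: 'r
  assumes "is_language L"
    and "le \<in> rel_symbols L" and "rel_arity L le = 2"
    and "infinite (UNIV :: 'v set)"
  shows "ramsey_class L (ordered_structures L le :: ('v, 'r, 'f) lstruct set)"
  unfolding ramsey_class_def
  using ordered_structures_arrow[OF assms] by (simp add: ordered_structures_def)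

end
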